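(* Let $\mathbb{F}\in\{\mathbb{R},\mathbb{C}\}$, let $C_1,\ldots,C_m\in\mathbb{F}^{n\times n}\setminus\{0\}$ be Hermitian matrices, and let $q=\dim_{\mathbb{F}}\left(\bigcap_{t=1}^m\ker C_t\right)$ (so $q<n$). For $\lambda=(\lambda_1,\ldots,\lambda_m)\in\mathbb{R}^m$ put $\mathbf{C}(\lambda)=\sum_{i=1}^m\lambda_iC_i$. 1) Suppose $q=0$. (a) If $\det\mathbf{C}(\lambda)=0$ for all $\lambda\in\mathbb{R}^m$, then $C_1,\ldots,C_m$ are not $\mathbb{F}$-SDC. (b) Otherwise, let $\lambda\in\mathbb{R}^m$ be such that $\mathbf{C}(\lambda)$ is nonsingular. Then $C_1,\ldots,C_m$ are $\mathbb{F}$-SDC if and only if the matrices $\mathbf{C}(\lambda)^{-1}C_1,\ldots,\mathbf{C}(\lambda)^{-1}C_m$ pairwise commute and every $\mathbf{C}(\lambda)^{-1}C_i$, $i=1,\ldots,m$, is similar to a real diagonal matrix. 2) Suppose $q>0$. Then there exists a nonsingular matrix $P\in\mathbb{F}^{n\times n}$ such that $$P^*C_iP=\begin{bmatrix}0_q&0\\0&\hat C_i\end{bmatrix},\quad i=1,\ldots,m,$$ where $0_q$ is the $q\times q$ zero matrix and each $\hat C_i\in\mathbb{F}^{(n-q)\times(n-q)}$ is Hermitian, with $\bigcap_{t=1}^m\ker\hat C_t=\{0\}$. Moreover, $C_1,\ldots,C_m$ are $\mathbb{F}$-SDC if and only if $\hat C_1,\ldots,\hat C_m$ are $\mathbb{F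}$-SDC.
   Context: $P^*$ denotes the conjugate transpose of $P$ (the transpose when $\mathbb{F}=\mathbb{R}$, in which case Hermitian means real symmetric). Kernels are taken in $\mathbb{F}^n$ (resp. $\mathbb{F}^{n-q}$). Hermitian matrices $A_1,\ldots,A_m\in\mathbb{F}^{k\times k}$ are called $\mathbb{F}$-SDC (simultaneously diagonalizable via $*$-congruence on $\mathbb{F}$) if there exists a nonsingular matrix $P\in\mathbb{F}^{k\times k}$ such that $P^*A_iP$ is diagonal for every $i=1,\ldots,m$. Similarity is understood over $\mathbb{F}$: $A\in\mathbb{F}^{k\times k}$ is similar to $D$ if $P^{-1}AP=D$ for some nonsingular $P\in\mathbb{F}^{k\times k}$. *)

theory Defs
  imports
    "Jordan_Normal_Form.Schur_Decomposition"
    "Jordan_Normal_Form.Gauss_Jordan_Elimination"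
    "Jordan_Normal_Form.Matrix_Kernel"
begin

(* The type 'a is the scalar field; conjugate is the identity on real and cnj on complex, so
   mat_adjoint is the transpose over the reals and the conjugate transpose over the complex numbers.
   A family C_1, ..., C_m is represented by C 0, ..., C (m - 1); values C i with i >= m are irrelevant. *)

definition hermitian_mat :: "'a::conjugatable_field mat \<Rightarrow> bool" where
  "hermitian_mat A \<longleftrightarrow> mat_adjoint A = A"

definition sdc :: "nat \<Rightarrow> nat \<Rightarrow> (nat \<Rightarrow> 'a::conjugatable_field mat) \<Rightarrow> bool" where
  "sdc k m A \<longleftrightarrow>
     (\<exists>P \<in> carrier_mat k k. invertible_mat P \<and>
        (\<forall>i<m. diagonal_mat (mat_adjoint P * A i * P)))"

(* The linear combination has real coefficients also when the matrices are complex. *)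
definition real_lincomb ::
    "nat \<Rightarrow> nat \<Rightarrow> (nat \<Rightarrow> 'a::{field, real_algebra_1} mat) \<Rightarrow> real vec \<Rightarrow> 'a mat" where
  "real_lincomb n m C l =
     mat n n (\<lambda>(r, c). \<Sum>i<m. of_real (l $ i) * C i $$ (r, c))"

(* The library inverse is partial: mat_inverse A is Some of the inverse if A is nonsingular,
   and None otherwise. inv_mat A is unspecified in the latter case. *)
definition inv_mat :: "'a::field mat \<Rightarrow> 'a mat" where
  "inv_mat A = the (mat_inverse A)"

definition common_kernel :: "nat \<Rightarrow> (nat \<Rightarrow> 'a::field mat) \<Rightarrow> 'a vec set" where
  "common_kernel m C = (\<Inter>i<m. mat_kernel (C i))"

(* The dimension over 'a of the common kernel as a subspace of 'a^n; this is the construction by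
   which the library defines the dimension of the kernel of a single matrix. *)
definition common_kernel_dim :: "nat \<Rightarrow> nat \<Rightarrow> (nat \<Rightarrow> 'a::field mat) \<Rightarrow> nat" where
  "common_kernel_dim n m C =
     vectorspace.dim class_ring (module_vec TYPE('a) n \<lparr>carrier := common_kernel m C\<rparr>)"

definition zero_block_reduction ::
    "nat \<Rightarrow> nat \<Rightarrow> nat \<Rightarrow> (nat \<Rightarrow> 'a::conjugatable_field mat) \<Rightarrow> 'a mat \<Rightarrow> (nat \<Rightarrow> 'a mat) \<Rightarrow> bool"
where
  "zero_block_reduction n q m C P C' \<longleftrightarrow>
     P \<in> carrier_mat n n \<and> invertible_mat P \<and>
     (\<forall>i<m. C' i \<in> carrier_mat (n - q) (n - q) \<and> hermitian_mat (C' i) \<and>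
        mat_adjoint P * C i * P =
          four_block_mat (0\<^sub>m q q) (0\<^sub>m q (n - q)) (0\<^sub>m (n - q) q) (C' i)) \<and>
     common_kernel m C' = {0\<^sub>v (n - q)}"

end

theory Submission
  imports Defs "Jordan_Normal_Form.DL_Rank"
begin

text \<open>
  The argument treats both fields at once; the scalars enter only through characteristic zero and
  the fact that the fixed points of conjugation are the real numbers.

  Suppose that the common kernel is trivial. A congruence that makes every \<open>C\<^sub>i\<close> diagonal makes
  every combination \<open>\<^bold>C(\<lambda>)\<close> diagonal as well, and no diagonal position vanishes in all the \<open>C\<^sub>i\<close>.
  Each position is then a nonzero linear form in \<open>\<lambda>\<close>, and a point \<open>(1, t, t\<^sup>2, \<dots>)\<close> of the moment curve
  avoids the zeros of these finitely many forms; so some combination is nonsingular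
  (\<open>sdc_imp_nonsingular_lincomb\<close>). Given a nonsingular \<open>A = \<^bold>C(\<lambda>)\<close>, the same congruence matrix
  diagonalizes the matrices \<open>A\<^sup>-\<^sup>1 C\<^sub>i\<close> by similarity, because it turns them into quotients of real
  diagonal matrices. Conversely, commuting matrices \<open>A\<^sup>-\<^sup>1 C\<^sub>i\<close> with real diagonal forms have a basis
  \<open>Q\<close> of joint eigenvectors (\<open>simultaneous_eigenbasis\<close>). Label each basis vector with its tuple of
  eigenvalues. Since \<open>H = Q\<^sup>* A Q\<close> and \<open>Q\<^sup>* C\<^sub>i Q = H \<Delta>\<^sub>i\<close> are Hermitian and the diagonal \<open>\<Delta>\<^sub>i\<close> are real,
  \<open>H\<close> has no entry between different labels. Lagrange's reduction of Hermitian forms, carried out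
  inside the blocks of equal label, gives a matrix \<open>R\<close> that diagonalizes \<open>H\<close> by congruence and commutes with every
  \<open>\<Delta>\<^sub>i\<close> (\<open>labelled_hermitian_diagonalization\<close>); so \<open>Q R\<close> diagonalizes every \<open>C\<^sub>i\<close>.

  In general, a basis of the common kernel is extended to a basis of the whole space, and in these
  coordinates the Hermitian matrices vanish on the first \<open>q\<close> rows and columns
  (\<open>zero_block_reduction_exists\<close>). If a congruence \<open>R\<close> diagonalizes the matrices \<open>0 \<oplus> C'\<^sub>i\<close>, then so
  does the lower part \<open>W\<close> of \<open>R\<close>, in the sense that \<open>W\<^sup>* C'\<^sub>i W\<close> is diagonal; \<open>W\<close> has full row rank, and
  any invertible selection of its columns diagonalizes the \<open>C'\<^sub>i\<close> (\<open>sdc_zero_block\<close>). Such selections, and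
  joint eigenbases, come from one observation (\<open>nonsingular_column_choice\<close>): if every column of a
  nonsingular matrix is a finite sum, then one summand can be chosen from every column such that the matrix
  of the chosen summands is nonsingular.
\<close>

section \<open>The two scalar fields\<close>

text \<open>
  Conjugation and the real numbers are tied together by one axiom. The reals are spelled out as
  the multiples of 1 because the constant \<open>\<real>\<close> requires more of its type than a class axiom may
  assume.
\<close>
class real_or_complex_field = conjugatable_field + real_field +
  assumes conjugate_fixed_iff_scaleR: "conjugate x = x \<longleftrightarrow> (\<exists>r. x = scaleR r 1)"

lemma conjugate_fixed_iff_Reals:
  fixes x :: "'a::real_or_complex_field"
  shows "conjugate x = x \<longleftrightarrow> x \<in> \<real>"
  unfolding conjugate_fixed_iff_scaleR Reals_def of_real_def by auto

instance real :: real_or_complex_field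
  by intro_classes simp

instance complex :: real_or_complex_field
  by intro_classes (auto simp: complex_eq_iff intro: exI[of _ "Re x" for x])

section \<open>Invertible, diagonal and adjoint matrices\<close>

lemma invertible_matI:
  fixes A B :: "'a::field mat"
  assumes "A \<in> carrier_mat n n" "B \<in> carrier_mat n n" "A * B = 1\<^sub>m n"
  shows "invertible_mat A"
  using assms mat_mult_left_right_inverse[OF assms]
  unfolding invertible_mat_def inverts_mat_def by auto

lemma invertible_matE:
  fixes A :: "'a::field mat"
  assumes "invertible_mat A" "A \<in> carrier_mat n n"
  obtains B where "B \<in> carrier_mat n n" "A * B = 1\<^sub>m n" "B * A = 1\<^sub>m n"
proof -
  from assms obtain B where B: "A * B = 1\<^sub>m n" "B * A = 1\<^sub>m (dim_row B)"
    unfolding invertible_mat_def inverts_mat_def by auto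
  from arg_cong[OF B(1), of dim_col] have "dim_col B = n" by simp
  moreover from arg_cong[OF B(2), of dim_col] assms(2) have "dim_row B = n" by simp
  ultimately have "B \<in> carrier_mat n n" by auto
  with B that show ?thesis by auto
qed

lemma invertible_mat_iff_det:
  fixes A :: "'a::field mat"
  assumes A: "A \<in> carrier_mat n n"
  shows "invertible_mat A \<longleftrightarrow> det A \<noteq> 0"
proof
  assume "invertible_mat A"
  from invertible_matE[OF this A] obtain B
    where B: "B \<in> carrier_mat n n" "A * B = 1\<^sub>m n" by metis
  from arg_cong[OF B(2), of det] show "det A \<noteq> 0"
    by (auto simp: det_mult[OF A B(1)])
next
  assume "det A \<noteq> 0"
  from det_non_zero_imp_unit[OF A this, of "()"] show "invertible_mat A"
    using invertible_matI[OF A] unfolding Units_def by (auto simp: ring_mat_def)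
qed

lemma invertible_mat_mult:
  fixes A B :: "'a::field mat"
  assumes "A \<in> carrier_mat n n" "B \<in> carrier_mat n n" "invertible_mat A" "invertible_mat B"
  shows "invertible_mat (A * B)"
  using assms by (simp add: invertible_mat_iff_det[of _ n] det_mult)

lemma inv_mat:
  fixes A :: "'a::field mat"
  assumes A: "A \<in> carrier_mat n n" and inv: "invertible_mat A"
  shows "inv_mat A \<in> carrier_mat n n" "A * inv_mat A = 1\<^sub>m n" "inv_mat A * A = 1\<^sub>m n"
proof -
  have "A \<in> Units (ring_mat TYPE('a) n ())"
    using det_non_zero_imp_unit[OF A] invertible_mat_iff_det[OF A] inv by auto
  with mat_inverse(1)[OF A, of "()"] obtain B where "mat_inverse A = Some B"
    by (cases "mat_inverse A") auto
  with mat_inverse(2)[OF A this]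
  show "inv_mat A \<in> carrier_mat n n" "A * inv_mat A = 1\<^sub>m n" "inv_mat A * A = 1\<^sub>m n"
    unfolding inv_mat_def by auto
qed

lemma invertible_mat_inverse:
  fixes A B :: "'a::field mat"
  assumes "A \<in> carrier_mat n n" "B \<in> carrier_mat n n" "A * B = 1\<^sub>m n"
  shows "invertible_mat B"
  using invertible_matI[OF assms(2,1)] mat_mult_left_right_inverse[OF assms] by simp

lemma mult_mat_left_cancel:
  fixes A :: "'a::field mat"
  assumes A: "A \<in> carrier_mat n n" "invertible_mat A"
    and X: "X \<in> carrier_mat n k" and Y: "Y \<in> carrier_mat n k" and eq: "A * X = A * Y"
  shows "X = Y"
proof -
  from invertible_matE[OF A(2,1)] obtain Z where Z: "Z \<in> carrier_mat n n" "Z * A = 1\<^sub>m n" by metis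
  from assoc_mult_mat[OF Z(1) A(1) X] assoc_mult_mat[OF Z(1) A(1) Y] eq Z(2) X Y show ?thesis by simp
qed

lemma mult_mat_vec_invertible_eq_0:
  fixes P :: "'a::field mat"
  assumes P: "P \<in> carrier_mat n n" "invertible_mat P" and v: "v \<in> carrier_vec n" and 0: "P *\<^sub>v v = 0\<^sub>v n"
  shows "v = 0\<^sub>v n"
proof -
  from invertible_matE[OF P(2,1)] obtain P' where P': "P' \<in> carrier_mat n n" "P' * P = 1\<^sub>m n" by metis
  have "P' *\<^sub>v (P *\<^sub>v v) = v" using assoc_mult_mat_vec[OF P'(1) P(1) v] P'(2) v by simp
  with 0 P' show ?thesis by auto
qed

lemma mult_mat_zero_vec:
  fixes A :: "'a::semiring_0 mat"
  assumes "A \<in> carrier_mat nr n"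
  shows "A *\<^sub>v 0\<^sub>v n = 0\<^sub>v nr"
  using assms by (intro eq_vecI) (auto simp: scalar_prod_def)

lemma index_mult_mat_sum:
  assumes "A \<in> carrier_mat nr n" "B \<in> carrier_mat n nc" "i < nr" "j < nc"
  shows "(A * B) $$ (i, j) = (\<Sum>k<n. A $$ (i, k) * B $$ (k, j))"
  using assms by (auto simp: scalar_prod_def lessThan_atLeast0 intro!: sum.cong)

text \<open>
  Multiplication from the left acts on each column separately, so a matrix assembled from columns
  of different matrices can be multiplied column by column.
\<close>
lemma index_mult_columnwise:
  assumes "B \<in> carrier_mat n n" "\<And>c. c < n \<Longrightarrow> M c \<in> carrier_mat n n" "r < n" "c < n"
  shows "(B * mat n n (\<lambda>(r, c). M c $$ (r, c))) $$ (r, c) = (B * M c) $$ (r, c)"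
proof -
  have "mat n n (\<lambda>(r, c). M c $$ (r, c)) \<in> carrier_mat n n" by simp
  from index_mult_mat_sum[OF assms(1) this assms(3,4)] index_mult_mat_sum[OF assms(1) assms(2)[OF assms(4)] assms(3,4)]
  show ?thesis using assms(4) by simp
qed

lemma diagonal_mat_eq_mat_diag:
  assumes "D \<in> carrier_mat n n" "diagonal_mat D"
  shows "D = mat_diag n (\<lambda>j. D $$ (j, j))"
  using assms by (intro eq_matI) (auto simp: mat_diag_def diagonal_mat_def)

lemma diagonal_mat_mat_diag [simp]: "diagonal_mat (mat_diag n f)"
  by (auto simp: diagonal_mat_def mat_diag_def)

lemma mat_diag_invertible_iff:
  fixes f :: "nat \<Rightarrow> 'a::field"
  shows "invertible_mat (mat_diag n f) \<longleftrightarrow> (\<forall>j<n. f j \<noteq> 0)"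
proof
  assume "invertible_mat (mat_diag n f)"
  from invertible_matE[OF this mat_diag_dim] obtain B
    where B: "B \<in> carrier_mat n n" "mat_diag n f * B = 1\<^sub>m n" by metis
  show "\<forall>j<n. f j \<noteq> 0"
  proof (intro allI impI)
    fix j assume j: "j < n"
    from arg_cong[OF B(2), of "\<lambda>X. X $$ (j, j)"] j show "f j \<noteq> 0"
      unfolding mat_diag_mult_left[OF B(1)] by auto
  qed
next
  assume f: "\<forall>j<n. f j \<noteq> 0"
  have "mat_diag n f * mat_diag n (\<lambda>j. inverse (f j)) = 1\<^sub>m n"
    using f unfolding mat_diag_diag by (intro eq_matI) (auto simp: mat_diag_def)
  then show "invertible_mat (mat_diag n f)" by (rule invertible_matI[OF mat_diag_dim mat_diag_dim])
qed

text \<open>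
  Similarity by a fixed matrix is multiplicative, so products of simultaneously diagonalized
  matrices can be computed on the diagonals.
\<close>
lemma similarity_mult:
  fixes S T :: "'a::field mat"
  assumes S: "S \<in> carrier_mat n n" and T: "T \<in> carrier_mat n n" and TS: "T * S = 1\<^sub>m n"
    and X: "X \<in> carrier_mat n n" and Y: "Y \<in> carrier_mat n n"
  shows "S * X * T * (S * Y * T) = S * (X * Y) * T"
proof -
  have "S * X * T * (S * Y * T) = S * X * (T * S) * Y * T"
    using S T X Y by (simp add: assoc_mult_mat[of _ n n _ n _ n] del: mult_carrier_mat add: mult_carrier_mat[of _ n n _ n])
  then show ?thesis using S T X Y by (simp add: TS assoc_mult_mat[of _ n n _ n _ n])
qed

lemma similar_mat_carrierE:
  assumes "similar_mat A D" "D \<in> carrier_mat n n"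
  obtains S T where "S \<in> carrier_mat n n" "T \<in> carrier_mat n n"
    "S * T = 1\<^sub>m n" "T * S = 1\<^sub>m n" "A = S * D * T"
proof -
  from similar_matD[OF assms(1)] obtain k S T
    where w: "{A, D, S, T} \<subseteq> carrier_mat k k" "S * T = 1\<^sub>m k" "T * S = 1\<^sub>m k" "A = S * D * T"
    by blast
  with assms(2) have "k = n" by auto
  with w that show ?thesis by auto
qed

lemma mat_adjoint_dim [simp]:
  "dim_row (mat_adjoint A) = dim_col A" "dim_col (mat_adjoint A) = dim_row A"
  unfolding mat_adjoint_def by auto

lemma mat_adjoint_carrier [simp]: "A \<in> carrier_mat nr nc \<Longrightarrow> mat_adjoint A \<in> carrier_mat nc nr"
  by auto

lemma mat_adjoint_index [simp]:
  "i < dim_col A \<Longrightarrow> j < dim_row A \<Longrightarrow> mat_adjoint A $$ (i, j) = conjugate (A $$ (j, i))"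
  unfolding mat_adjoint_def by (simp add: mat_of_rows_index)

lemma mat_adjoint_mult:
  assumes A: "A \<in> carrier_mat nr n" and B: "B \<in> carrier_mat n nc"
  shows "mat_adjoint (A * B) = mat_adjoint B * mat_adjoint A"
proof (rule eq_matI)
  fix i j assume "i < dim_row (mat_adjoint B * mat_adjoint A)" "j < dim_col (mat_adjoint B * mat_adjoint A)"
  with A B have i: "i < nc" and j: "j < nr" by auto
  show "mat_adjoint (A * B) $$ (i, j) = (mat_adjoint B * mat_adjoint A) $$ (i, j)"
    using A B i j
    by (auto simp: index_mult_mat_sum[OF A B] index_mult_mat_sum[OF mat_adjoint_carrier[OF B] mat_adjoint_carrier[OF A]]
        sum_conjugate conjugate_dist_mul mult.commute simp del: index_mult_mat(1) intro!: sum.cong)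
qed (use A B in auto)

lemma mat_adjoint_adjoint [simp]: "mat_adjoint (mat_adjoint A) = A"
  by (rule eq_matI) auto

lemma conjugate_one [simp]: "conjugate (1::'a::conjugatable_field) = 1"
proof -
  have "conjugate (1::'a) * conjugate 1 = conjugate 1 * 1"
    using conjugate_dist_mul[of "1::'a" 1] by simp
  then show ?thesis
    using conjugate_zero_iff[of "1::'a"] by (metis mult_left_cancel zero_neq_one)
qed

lemma mat_adjoint_one [simp]: "mat_adjoint (1\<^sub>m n :: 'a::conjugatable_field mat) = 1\<^sub>m n"
  by (rule eq_matI) auto

lemma invertible_mat_adjoint:
  assumes A: "A \<in> carrier_mat n n" and inv: "invertible_mat A"
  shows "invertible_mat (mat_adjoint A)"
proof -
  from invertible_matE[OF inv A] obtain B
    where B: "B \<in> carrier_mat n n" "B * A = 1\<^sub>m n" by metis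
  have "mat_adjoint A * mat_adjoint B = 1\<^sub>m n"
    using mat_adjoint_mult[OF B(1) A] B(2) by simp
  with A B show ?thesis by (intro invertible_matI[of _ n "mat_adjoint B"]) auto
qed

lemma hermitian_mat_congruence:
  assumes H: "H \<in> carrier_mat n n" "hermitian_mat H" and P: "P \<in> carrier_mat n k"
  shows "hermitian_mat (mat_adjoint P * H * P)"
proof -
  have "mat_adjoint (mat_adjoint P * H * P) = mat_adjoint P * (mat_adjoint H * P)"
    using H P by (subst mat_adjoint_mult[of _ k n _ k], auto, subst mat_adjoint_mult[of _ k n _ n], auto)
  then show ?thesis
    using H P unfolding hermitian_mat_def by (auto intro!: assoc_mult_mat[symmetric])
qed

lemma hermitian_mat_index:
  assumes "hermitian_mat H" "H \<in> carrier_mat n n" "i < n" "j < n"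
  shows "conjugate (H $$ (i, j)) = H $$ (j, i)"
  using assms mat_adjoint_index[of j H i] unfolding hermitian_mat_def by auto

lemma congruence_mult:
  assumes "C \<in> carrier_mat n n" "P \<in> carrier_mat n k" "Q \<in> carrier_mat k l"
  shows "mat_adjoint (P * Q) * C * (P * Q) = mat_adjoint Q * (mat_adjoint P * C * P) * Q"
proof -
  note C = assms(1) and P = assms(2) and Q = assms(3)
  have X: "mat_adjoint P * C \<in> carrier_mat k n" and Q': "mat_adjoint Q \<in> carrier_mat l k"
    using C P Q by auto
  have "mat_adjoint (P * Q) * C * (P * Q) = mat_adjoint Q * (mat_adjoint P * C) * (P * Q)"
    unfolding mat_adjoint_mult[OF P Q] using C P Q by (simp add: assoc_mult_mat[of _ l k _ n _ n])
  also have "\<dots> = mat_adjoint Q * (mat_adjoint P * C) * P * Q"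
    by (rule assoc_mult_mat[OF mult_carrier_mat[OF Q' X] P Q, symmetric])
  also have "\<dots> = mat_adjoint Q * (mat_adjoint P * C * P) * Q"
    by (simp add: assoc_mult_mat[OF Q' X P])
  finally show ?thesis .
qed

lemma congruence_index:
  assumes C: "C \<in> carrier_mat n n" and P: "P \<in> carrier_mat n k" and xy: "x < k" "y < k"
  shows "(mat_adjoint P * C * P) $$ (x, y)
    = (\<Sum>b<n. (\<Sum>a<n. conjugate (P $$ (a, x)) * C $$ (a, b)) * P $$ (b, y))"
proof -
  have PC: "mat_adjoint P * C \<in> carrier_mat k n"
    by (rule mult_carrier_mat[OF mat_adjoint_carrier[OF P] C])
  show ?thesis
    unfolding index_mult_mat_sum[OF PC P xy]
    using P xy by (intro sum.cong refl)
      (simp add: index_mult_mat_sum[OF mat_adjoint_carrier[OF P] C] del: index_mult_mat(1))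
qed

section \<open>Congruence invariance\<close>

text \<open>
  Congruences compose and can be inverted, so passing to a congruent family neither creates nor
  destroys a diagonalizing congruence.
\<close>
lemma sdc_congruence:
  assumes P: "P \<in> carrier_mat n n" and inv: "invertible_mat P"
    and C: "\<And>i. i < m \<Longrightarrow> C i \<in> carrier_mat n n"
  shows "sdc n m (\<lambda>i. mat_adjoint P * C i * P) \<longleftrightarrow> sdc n m C"
proof
  assume "sdc n m (\<lambda>i. mat_adjoint P * C i * P)"
  then obtain Q where Q: "Q \<in> carrier_mat n n" "invertible_mat Q"
    "\<And>i. i < m \<Longrightarrow> diagonal_mat (mat_adjoint Q * (mat_adjoint P * C i * P) * Q)"
    unfolding sdc_def by auto
  show "sdc n m C" unfolding sdc_def
    by (intro bexI[of _ "P * Q"]) (use P inv C Q in \<open>auto simp: congruence_mult[of _ n P n Q n] invertible_mat_mult[of _ n]\<close>)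
next
  assume "sdc n m C"
  then obtain R where R: "R \<in> carrier_mat n n" "invertible_mat R"
    "\<And>i. i < m \<Longrightarrow> diagonal_mat (mat_adjoint R * C i * R)"
    unfolding sdc_def by auto
  from invertible_matE[OF inv P] obtain P' where P': "P' \<in> carrier_mat n n" "P * P' = 1\<^sub>m n" by metis
  have invP': "invertible_mat P'" by (rule invertible_mat_inverse[OF P P'])
  have R': "P * (P' * R) = R"
    using P P' R by (simp add: assoc_mult_mat[symmetric, of P n n P' n R n])
  show "sdc n m (\<lambda>i. mat_adjoint P * C i * P)" unfolding sdc_def
  proof (intro bexI[of _ "P' * R"] conjI allI impI)
    fix i assume i: "i < m"
    show "diagonal_mat (mat_adjoint (P' * R) * (mat_adjoint P * C i * P) * (P' * R))"
      using congruence_mult[OF C[OF i] P, of "P' * R" n] R' R(3)[OF i] P' R(1) by simp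
  qed (use P' R invP' in \<open>auto simp: invertible_mat_mult[of _ n]\<close>)
qed

lemma sdc_cong:
  assumes "\<And>i. i < m \<Longrightarrow> A i = B i"
  shows "sdc n m A \<longleftrightarrow> sdc n m B"
  unfolding sdc_def using assms by simp

section \<open>Choosing columns by multilinearity of the determinant\<close>

text \<open>
  Expanding the determinant multilinearly in its columns writes it as the sum, over all choices of
  one summand per column, of the determinants of the chosen columns. If the total is nonzero, so
  is some term.
\<close>
lemma nonsingular_column_choice:
  fixes a :: "nat \<Rightarrow> 's \<Rightarrow> nat \<Rightarrow> 'a::field"
  assumes S: "finite S"
    and det: "det (mat n n (\<lambda>(r, c). \<Sum>s\<in>S. a c s r)) \<noteq> 0"
  obtains f where "\<And>c. c < n \<Longrightarrow> f c \<in> S" "det (mat n n (\<lambda>(r, c). a c (f c) r)) \<noteq> 0"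
proof -
  obtain h where h: "bij_betw h {0..<card S} S" using ex_bij_betw_nat_finite[OF S] by blast
  define b where "b c k = vec n (a c (h k))" for c k
  have b: "b \<in> {0..<n} \<rightarrow> {0..<card S} \<rightarrow> carrier_vec n" by (auto simp: b_def)
  have "mat\<^sub>r n n (\<lambda>c. finsum_vec TYPE('a) n (b c) {0..<card S})
    = transpose_mat (mat n n (\<lambda>(r, c). \<Sum>s\<in>S. a c s r))"
    by (rule eq_matI)
      (auto simp: index_finsum_vec b_def finsum_vec_closed sum.reindex_bij_betw[OF h, symmetric])
  with det have "det (mat\<^sub>r n n (\<lambda>c. finsum_vec TYPE('a) n (b c) {0..<card S})) \<noteq> 0"
    by (simp add: det_transpose[of _ n])
  then obtain g where g: "\<forall>c\<in>{0..<n}. g c \<in> {0..<card S}" "det (mat\<^sub>r n n (\<lambda>c. b c (g c))) \<noteq> 0"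
    unfolding det_linear_rows_sum[OF _ b, simplified] by (auto elim!: sum.not_neutral_contains_not_neutral)
  have "mat\<^sub>r n n (\<lambda>c. b c (g c)) = transpose_mat (mat n n (\<lambda>(r, c). a c (h (g c)) r))"
    by (rule eq_matI) (auto simp: b_def)
  with g(2) have "det (mat n n (\<lambda>(r, c). a c (h (g c)) r)) \<noteq> 0"
    by (simp add: det_transpose[of _ n])
  moreover have "h (g c) \<in> S" if "c < n" for c
    using that g(1) h by (auto simp: bij_betw_def)
  ultimately show ?thesis using that[of "\<lambda>c. h (g c)"] by blast
qed

text \<open>
  A right inverse \<open>Y\<close> writes each unit vector as a combination of the columns of \<open>W\<close>; the choice of
  summands then selects columns up to nonzero factors. A column selected twice would make the
  determinant vanish, so the selection is injective.
\<close>
lemma nonsingular_column_selection: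
  fixes W :: "'a::field mat"
  assumes W: "W \<in> carrier_mat k N" and Y: "Y \<in> carrier_mat N k" and WY: "W * Y = 1\<^sub>m k"
  obtains f where "\<And>c. c < k \<Longrightarrow> f c < N" "inj_on f {..<k}" "invertible_mat (mat k k (\<lambda>(r, c). W $$ (r, f c)))"
proof -
  have "mat k k (\<lambda>(r, c). \<Sum>s<N. W $$ (r, s) * Y $$ (s, c)) = 1\<^sub>m k"
    unfolding WY[symmetric] using W Y
    by (intro eq_matI) (auto simp: index_mult_mat_sum[OF W Y] simp del: index_mult_mat(1))
  then have "det (mat k k (\<lambda>(r, c). \<Sum>s<N. W $$ (r, s) * Y $$ (s, c))) \<noteq> 0" by simp
  from nonsingular_column_choice[OF _ this] obtain f where f: "\<And>c. c < k \<Longrightarrow> f c < N"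
    and det: "det (mat k k (\<lambda>(r, c). W $$ (r, f c) * Y $$ (f c, c))) \<noteq> 0" by auto
  let ?V = "mat k k (\<lambda>(r, c). W $$ (r, f c))"
  have V: "?V \<in> carrier_mat k k" by simp
  have "mat k k (\<lambda>(r, c). W $$ (r, f c) * Y $$ (f c, c)) = ?V * mat_diag k (\<lambda>c. Y $$ (f c, c))"
    unfolding mat_diag_mult_right[OF V] by (rule eq_matI) auto
  with det have dV: "det ?V \<noteq> 0" by (auto simp: det_mult[OF V mat_diag_dim])
  have "inj_on f {..<k}"
  proof (rule inj_onI, rule ccontr)
    fix a b assume ab: "a \<in> {..<k}" "b \<in> {..<k}" "f a = f b" "a \<noteq> b"
    then have "col ?V a = col ?V b" by (intro eq_vecI) auto
    with det_identical_columns[OF V ab(4)] ab dV show False by auto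
  qed
  with f dV invertible_mat_iff_det[OF V] that show ?thesis by blast
qed

section \<open>Simultaneous diagonalization of commuting matrices\<close>

text \<open>
  The eigenprojections of the diagonalizable matrix \<open>M\<close>. They commute with everything that commutes
  with \<open>M\<close>: in the eigenbasis, a matrix commutes with a diagonal matrix iff it has no entries
  between different eigenvalues, and then it commutes with the diagonal matrix of each eigenspace.
  Their sum is the identity.
\<close>
lemma spectral_projectors:
  fixes S T :: "'a::field mat" and d :: "nat \<Rightarrow> 'a"
  assumes S: "S \<in> carrier_mat n n" and T: "T \<in> carrier_mat n n"
    and ST: "S * T = 1\<^sub>m n" and TS: "T * S = 1\<^sub>m n"
  defines "E \<equiv> \<lambda>z. S * mat_diag n (\<lambda>j. if d j = z then 1 else 0) * T"
    and "M \<equiv> S * mat_diag n d * T"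
  shows "E z \<in> carrier_mat n n"
    and "M * E z = z \<cdot>\<^sub>m E z"
    and "N \<in> carrier_mat n n \<Longrightarrow> M * N = N * M \<Longrightarrow> E z * N = N * E z"
    and "Q \<in> carrier_mat n n \<Longrightarrow> r < n \<Longrightarrow> c < n \<Longrightarrow>
      (\<Sum>z\<in>d ` {..<n}. (E z * Q) $$ (r, c)) = Q $$ (r, c)"
proof -
  let ?e = "\<lambda>z. mat_diag n (\<lambda>j. if d j = z then 1 else 0 :: 'a)"
  show E: "E z \<in> carrier_mat n n" for z using S T unfolding E_def by auto
  note cancel = similarity_mult[OF S T TS]
  have dz: "mat_diag n d * ?e z = z \<cdot>\<^sub>m ?e z"
    unfolding mat_diag_diag by (rule eq_matI) (auto simp: mat_diag_def)
  have "M * E z = S * (mat_diag n d * ?e z) * T"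
    unfolding M_def E_def by (rule cancel) simp_all
  also have "\<dots> = z \<cdot>\<^sub>m (S * ?e z) * T"
    unfolding dz using mult_smult_distrib[OF S mat_diag_dim] by simp
  also have "\<dots> = z \<cdot>\<^sub>m E z"
    unfolding E_def using mult_smult_assoc_mat[OF _ T, of "S * ?e z" n z] S by simp
  finally show "M * E z = z \<cdot>\<^sub>m E z" .
  show "E z * N = N * E z" if N: "N \<in> carrier_mat n n" and MN: "M * N = N * M"
  proof -
    define X where "X = T * N * S"
    have X: "X \<in> carrier_mat n n" using T N S by (simp add: X_def)
    have N_eq: "N = S * X * T"
    proof -
      have "S * X * T = (S * T) * N * (S * T)"
        unfolding X_def using S T N by (simp add: assoc_mult_mat[of _ n n _ n _ n])
      then show ?thesis using N ST by simp
    qed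
    have inj: "Y = Z" if "S * Y * T = S * Z * T" "Y \<in> carrier_mat n n" "Z \<in> carrier_mat n n" for Y Z
    proof -
      have "(T * S) * W * (T * S) = T * (S * W * T) * S" if "W \<in> carrier_mat n n" for W
        using S T that by (simp add: assoc_mult_mat[of _ n n _ n _ n])
      from this[of Y] this[of Z] that TS show ?thesis by simp
    qed
    have "mat_diag n d * X = X * mat_diag n d"
    proof (rule inj)
      show "S * (mat_diag n d * X) * T = S * (X * mat_diag n d) * T"
        using MN unfolding N_eq M_def cancel[OF mat_diag_dim X] cancel[OF X mat_diag_dim] .
    qed (use mult_carrier_mat[OF mat_diag_dim X] mult_carrier_mat[OF X mat_diag_dim] in auto)
    from this[unfolded mat_diag_mult_left[OF X] mat_diag_mult_right[OF X]]
    have "d a * X $$ (a, b) = X $$ (a, b) * d b" if "a < n" "b < n" for a b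
      using that by (auto dest: arg_cong[of _ _ "\<lambda>Y. Y $$ (a, b)"])
    then have X0: "X $$ (a, b) = 0" if "a < n" "b < n" "d a \<noteq> d b" for a b
      using that by (metis mult.commute mult_right_cancel)
    have "?e z * X = X * ?e z"
      unfolding mat_diag_mult_left[OF X] mat_diag_mult_right[OF X]
      by (intro eq_matI) (auto simp: X0)
    then show ?thesis unfolding N_eq E_def cancel[OF mat_diag_dim X] cancel[OF X mat_diag_dim] by simp
  qed
  show "(\<Sum>z\<in>d ` {..<n}. (E z * Q) $$ (r, c)) = Q $$ (r, c)"
    if Q: "Q \<in> carrier_mat n n" and rc: "r < n" "c < n"
  proof -
    have TQ: "T * Q \<in> carrier_mat n n" using T Q by simp
    have ent: "(E z * Q) $$ (r, c) = (\<Sum>k<n. if d k = z then S $$ (r, k) * (T * Q) $$ (k, c) else 0)" for z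
    proof -
      have "E z * Q = mat n n (\<lambda>(i, j). S $$ (i, j) * (if d j = z then 1 else 0)) * (T * Q)"
        unfolding E_def assoc_mult_mat[OF mult_carrier_mat[OF S mat_diag_dim] T Q]
        unfolding mat_diag_mult_right[OF S] ..
      then show ?thesis
        unfolding index_mult_mat_sum[OF mat_carrier TQ rc]
        using rc by (auto simp: index_mult_mat_sum[OF mat_carrier TQ rc] simp del: index_mult_mat(1) intro!: sum.cong)
    qed
    have "(\<Sum>z\<in>d ` {..<n}. (E z * Q) $$ (r, c))
      = (\<Sum>k<n. \<Sum>z\<in>d ` {..<n}. if d k = z then S $$ (r, k) * (T * Q) $$ (k, c) else 0)"
      unfolding ent by (rule sum.swap)
    also have "\<dots> = (\<Sum>k<n. S $$ (r, k) * (T * Q) $$ (k, c))"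
      by (intro sum.cong) auto
    also have "\<dots> = (S * (T * Q)) $$ (r, c)"
      by (rule index_mult_mat_sum[OF S TQ rc, symmetric])
    also have "S * (T * Q) = Q" using S T Q ST by (simp add: assoc_mult_mat[symmetric, of S n n T n Q n])
    finally show ?thesis .
  qed
qed

text \<open>
  Induction on the number of matrices. Given joint eigenvectors of the first \<open>m\<close> matrices, split
  each of them by the eigenprojections of the next one. These projections commute with the earlier
  matrices, so the pieces are eigenvectors of all of them, with the same eigenvalues as before;
  and one piece of each vector can be kept such that the kept pieces still form a basis. The set \<open>X\<close>
  records where the eigenvalues lie.
\<close>
lemma simultaneous_eigenbasis:
  fixes B :: "nat \<Rightarrow> 'a::field mat"
  assumes "\<And>i. i < m \<Longrightarrow> \<exists>D\<in>carrier_mat n n. diagonal_mat D \<and> elements_mat D \<subseteq> X \<and> similar_mat (B i) D"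
    and "\<And>i j. i < m \<Longrightarrow> j < m \<Longrightarrow> B i * B j = B j * B i"
  shows "\<exists>Q\<in>carrier_mat n n. \<exists>\<mu>. invertible_mat Q \<and>
    (\<forall>i<m. B i * Q = Q * mat_diag n (\<mu> i) \<and> (\<forall>c<n. \<mu> i c \<in> X))"
  using assms
proof (induction m)
  case 0
  show ?case by (intro bexI[of _ "1\<^sub>m n"]) (auto simp: invertible_mat_iff_det[of _ n])
next
  case (Suc m)
  from Suc.IH Suc.prems obtain Q \<mu> where Q: "Q \<in> carrier_mat n n" "invertible_mat Q"
    and \<mu>: "\<And>i. i < m \<Longrightarrow> B i * Q = Q * mat_diag n (\<mu> i)" "\<And>i c. i < m \<Longrightarrow> c < n \<Longrightarrow> \<mu> i c \<in> X"
    by (metis less_Suc_eq)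
  from Suc.prems(1)[of m] obtain D where D: "D \<in> carrier_mat n n" "diagonal_mat D" "elements_mat D \<subseteq> X"
    and sim: "similar_mat (B m) D" by auto
  have B: "B i \<in> carrier_mat n n" if i: "i \<le> m" for i
  proof -
    from Suc.prems(1)[of i] i obtain D where "D \<in> carrier_mat n n" "similar_mat (B i) D" by auto
    from similar_mat_carrierE[OF this(2,1)] show ?thesis by (metis \<open>D \<in> carrier_mat n n\<close> mult_carrier_mat)
  qed
  from similar_mat_carrierE[OF sim D(1)] obtain S T
    where S: "S \<in> carrier_mat n n" and T: "T \<in> carrier_mat n n"
    and ST: "S * T = 1\<^sub>m n" and TS: "T * S = 1\<^sub>m n" and Bm: "B m = S * D * T" by blast
  define d where "d j = D $$ (j, j)" for j
  have Bm: "B m = S * mat_diag n d * T"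
    using Bm diagonal_mat_eq_mat_diag[OF D(1,2)] unfolding d_def by simp
  have dX: "d j \<in> X" if "j < n" for j using elements_matI[OF D(1) that that] D(3) unfolding d_def by auto
  define E where "E z = S * mat_diag n (\<lambda>j. if d j = z then 1 else 0) * T" for z
  note proj = spectral_projectors[OF S T ST TS, where d = d, folded E_def Bm]
  have "mat n n (\<lambda>(r, c). \<Sum>z\<in>d ` {..<n}. (E z * Q) $$ (r, c)) = Q"
    using proj(4)[OF Q(1)] Q(1) by (intro eq_matI) auto
  then have "det (mat n n (\<lambda>(r, c). \<Sum>z\<in>d ` {..<n}. (E z * Q) $$ (r, c))) \<noteq> 0"
    using Q by (simp add: invertible_mat_iff_det[of _ n])
  from nonsingular_column_choice[OF _ this] obtain f
    where f: "\<And>c. c < n \<Longrightarrow> f c \<in> d ` {..<n}"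
      and det: "det (mat n n (\<lambda>(r, c). (E (f c) * Q) $$ (r, c))) \<noteq> 0" by blast
  define Q' where "Q' = mat n n (\<lambda>(r, c). (E (f c) * Q) $$ (r, c))"
  have Q': "Q' \<in> carrier_mat n n" by (simp add: Q'_def)
  have EQ: "E z * Q \<in> carrier_mat n n" for z by (rule mult_carrier_mat[OF proj(1) Q(1)])
  have BQ': "(B i * Q') $$ (r, c) = (B i * E (f c) * Q) $$ (r, c)" if "i \<le> m" "r < n" "c < n" for i r c
    using index_mult_columnwise[OF B[OF that(1)] EQ that(2,3)] B[OF that(1)] Q proj(1)
    unfolding Q'_def by (simp add: assoc_mult_mat[OF B[OF that(1)] proj(1) Q(1)] del: index_mult_mat(1))
  have "B m * Q' = Q' * mat_diag n f"
    unfolding mat_diag_mult_right[OF Q']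
  proof (rule eq_matI)
    fix r c assume "r < dim_row (mat n n (\<lambda>(i, j). Q' $$ (i, j) * f j))" "c < dim_col (mat n n (\<lambda>(i, j). Q' $$ (i, j) * f j))"
    then have rc: "r < n" "c < n" by auto
    have "(B m * E (f c) * Q) $$ (r, c) = (f c \<cdot>\<^sub>m (E (f c) * Q)) $$ (r, c)"
      unfolding proj(2) using mult_smult_assoc_mat[OF proj(1) Q(1)] by simp
    with carrier_matD[OF proj(1)[of "f c"]] carrier_matD[OF Q(1)] rc show "(B m * Q') $$ (r, c) = mat n n (\<lambda>(i, j). Q' $$ (i, j) * f j) $$ (r, c)"
      by (simp add: BQ' del: index_mult_mat(1)) (simp add: Q'_def mult.commute del: index_mult_mat(1))
  qed (use B[of m] Q' in auto)
  moreover have "B i * Q' = Q' * mat_diag n (\<mu> i)" if i: "i < m" for i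
    unfolding mat_diag_mult_right[OF Q']
  proof (rule eq_matI)
    fix r c assume "r < dim_row (mat n n (\<lambda>(k, j). Q' $$ (k, j) * \<mu> i j))" "c < dim_col (mat n n (\<lambda>(k, j). Q' $$ (k, j) * \<mu> i j))"
    then have rc: "r < n" "c < n" by auto
    have Bi: "B i \<in> carrier_mat n n" using B i by simp
    have "B m * B i = B i * B m" using Suc.prems(2)[of m i] i by simp
    from proj(3)[OF Bi this] have "B i * E (f c) * Q = E (f c) * (B i * Q)"
      using Bi Q proj(1) by (simp add: mult_carrier_mat[of _ n n _ n] assoc_mult_mat[of _ n n _ n _ n, symmetric])
    also have "\<dots> = E (f c) * Q * mat_diag n (\<mu> i)"
      using \<mu>(1)[OF i] Q proj(1) by (simp add: mult_carrier_mat[of _ n n _ n] assoc_mult_mat[of _ n n _ n _ n, symmetric])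
    finally have "(B i * Q') $$ (r, c) = (E (f c) * Q * mat_diag n (\<mu> i)) $$ (r, c)"
      using BQ'[of i r c] i rc by simp
    with rc show "(B i * Q') $$ (r, c) = mat n n (\<lambda>(k, j). Q' $$ (k, j) * \<mu> i j) $$ (r, c)"
      unfolding mat_diag_mult_right[OF EQ] by (simp add: Q'_def del: index_mult_mat(1))
  qed (use B[of i] i Q' in auto)
  moreover have "invertible_mat Q'" using det invertible_mat_iff_det[OF Q'] by (simp add: Q'_def)
  moreover have "f c \<in> X" if "c < n" for c using f[OF that] dX by auto
  ultimately show ?case
    using Q' \<mu>(2)
    by (intro bexI[of _ Q'] exI[of _ "\<mu>(m := f)"]) (auto simp: less_Suc_eq)
qed

section \<open>Diagonalizing a Hermitian form inside the blocks of a labelling\<close>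

text \<open>
  The matrix \<open>1 + e\<^sub>p r\<^sup>T\<close>. It is a transvection in the usual sense, with inverse \<open>1 - e\<^sub>p r\<^sup>T\<close>, when
  \<open>r p = 0\<close>. Both steps of the reduction of a Hermitian form are congruences by such matrices.
\<close>
definition transvection :: "nat \<Rightarrow> nat \<Rightarrow> (nat \<Rightarrow> 'a::comm_ring_1) \<Rightarrow> 'a mat" where
  "transvection n p r = mat n n (\<lambda>(a, b). (if a = b then 1 else 0) + (if a = p then r b else 0))"

lemma transvection_carrier [simp]: "transvection n p r \<in> carrier_mat n n"
  by (simp add: transvection_def)

lemma mult_transvection_index:
  assumes M: "M \<in> carrier_mat n n" and p: "p < n" and xy: "x < n" "y < n"
  shows "(M * transvection n p r) $$ (x, y) = M $$ (x, y) + M $$ (x, p) * r y"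
proof -
  have "(M * transvection n p r) $$ (x, y)
    = (\<Sum>k<n. M $$ (x, k) * (if k = y then 1 else 0) + M $$ (x, k) * (if k = p then r y else 0))"
    unfolding index_mult_mat_sum[OF M transvection_carrier xy]
    using xy by (intro sum.cong) (auto simp: transvection_def algebra_simps)
  then show ?thesis using p xy by (simp add: sum.distrib if_distrib[of "\<lambda>t. _ * t"] cong: if_cong)
qed

lemma invertible_transvection:
  fixes r :: "nat \<Rightarrow> 'a::field"
  assumes p: "p < n" and r: "r p = 0"
  shows "invertible_mat (transvection n p r)"
proof (rule invertible_matI)
  show "transvection n p r * transvection n p (\<lambda>b. - r b) = 1\<^sub>m n"
    using p r by (intro eq_matI)
      (auto simp: mult_transvection_index[OF transvection_carrier] simp del: index_mult_mat(1), auto simp: transvection_def)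
qed auto

lemma congruence_transvection_index:
  fixes H :: "'a::conjugatable_field mat"
  assumes H: "H \<in> carrier_mat n n" and p: "p < n" and xy: "x < n" "y < n"
  shows "(mat_adjoint (transvection n p r) * H * transvection n p r) $$ (x, y)
    = H $$ (x, y) + H $$ (x, p) * r y + conjugate (r x) * (H $$ (p, y) + H $$ (p, p) * r y)"
proof -
  let ?R = "transvection n p r"
  have left: "(mat_adjoint ?R * H) $$ (x, y) = H $$ (x, y) + conjugate (r x) * H $$ (p, y)"
    if y: "y < n" for y
  proof -
    have "(mat_adjoint ?R * H) $$ (x, y)
      = (\<Sum>k<n. (if k = x then 1 else 0) * H $$ (k, y) + (if k = p then conjugate (r x) else 0) * H $$ (k, y))"
      unfolding index_mult_mat_sum[OF mat_adjoint_carrier[OF transvection_carrier] H xy(1) y]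
      using xy by (intro sum.cong) (auto simp: transvection_def algebra_simps conjugate_dist_add)
    then show ?thesis using p xy by (simp add: sum.distrib if_distrib[of "\<lambda>t. t * _"] cong: if_cong)
  qed
  have "mat_adjoint ?R * H \<in> carrier_mat n n" using H by (auto simp: transvection_def)
  from mult_transvection_index[OF this p xy] show ?thesis
    using left p xy by (simp add: algebra_simps)
qed

text \<open>
  Block diagonality for the partition of the indices by the labels \<open>d\<close>; the indices of one block
  need not be adjacent, so no reordering of the basis is ever needed.
\<close>
definition respects_labels :: "nat \<Rightarrow> (nat \<Rightarrow> 'l) \<Rightarrow> 'a::zero mat \<Rightarrow> bool" where
  "respects_labels n d M \<longleftrightarrow> (\<forall>a<n. \<forall>b<n. M $$ (a, b) \<noteq> 0 \<longrightarrow> d a = d b)"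

lemma respects_labels_mult:
  assumes M: "M \<in> carrier_mat n n" "respects_labels n d M"
    and N: "N \<in> carrier_mat n n" "respects_labels n d (N :: 'a::semiring_no_zero_divisors mat)"
  shows "respects_labels n d (M * N)"
  unfolding respects_labels_def
proof (intro allI impI)
  fix a b assume a: "a < n" and b: "b < n" and "(M * N) $$ (a, b) \<noteq> 0"
  then obtain k where "k < n" "M $$ (a, k) * N $$ (k, b) \<noteq> 0"
    unfolding index_mult_mat_sum[OF M(1) N(1) a b] by (auto elim: sum.not_neutral_contains_not_neutral)
  with a b M(2) N(2) show "d a = d b" unfolding respects_labels_def by (metis mult_zero_left mult_zero_right)
qed

lemma respects_labels_adjoint:
  assumes "M \<in> carrier_mat n n" "respects_labels n d M"
  shows "respects_labels n d (mat_adjoint M)"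
  using assms unfolding respects_labels_def by (metis carrier_matD conjugate_zero_iff mat_adjoint_index)

lemma respects_labels_transvection:
  assumes "\<And>b. b < n \<Longrightarrow> r b \<noteq> 0 \<Longrightarrow> d b = d p"
  shows "respects_labels n d (transvection n p r)"
  unfolding respects_labels_def transvection_def using assms by (auto split: if_splits)

text \<open>
  Lagrange's reduction. The set \<open>U\<close> contains all indices that still have off-diagonal entries. A
  nonzero diagonal entry in \<open>U\<close> serves as a pivot that clears its row and column. If all diagonal
  entries in \<open>U\<close> vanish but \<open>H\<^sub>c\<^sub>b \<noteq> 0\<close>, the basis vector \<open>e\<^sub>c\<close> is first replaced by \<open>e\<^sub>c + z e\<^sub>b\<close>, with \<open>z\<close> the
  conjugate of \<open>H\<^sub>c\<^sub>b\<close>. The new diagonal entry is the nonzero number \<open>2 |H\<^sub>c\<^sub>b|\<^sup>2\<close>. Both steps only mix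
  indices joined by a nonzero entry of \<open>H\<close>, hence indices of equal label.
\<close>
lemma labelled_hermitian_diagonalization:
  fixes H :: "'a::real_or_complex_field mat"
  assumes "H \<in> carrier_mat n n" "hermitian_mat H" "respects_labels n d H"
  shows "\<exists>R\<in>carrier_mat n n. invertible_mat R \<and> respects_labels n d R \<and> diagonal_mat (mat_adjoint R * H * R)"
proof -
  define solved where "solved H \<longleftrightarrow>
    (\<exists>R\<in>carrier_mat n n. invertible_mat R \<and> respects_labels n d R \<and> diagonal_mat (mat_adjoint R * H * R))" for H :: "'a mat"
  define form where "form U H \<longleftrightarrow> H \<in> carrier_mat n n \<and> hermitian_mat H \<and> respects_labels n d H
    \<and> (\<forall>a<n. \<forall>b<n. a \<notin> U \<longrightarrow> a \<noteq> b \<longrightarrow> H $$ (a, b) = 0)" for U and H :: "'a mat"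
  have transfer: "solved H" if H: "H \<in> carrier_mat n n" and R: "R \<in> carrier_mat n n" "invertible_mat R" "respects_labels n d R"
    and s: "solved (mat_adjoint R * H * R)" for R H
  proof -
    from s obtain R' where R': "R' \<in> carrier_mat n n" "invertible_mat R'" "respects_labels n d R'"
      "diagonal_mat (mat_adjoint R' * (mat_adjoint R * H * R) * R')" unfolding solved_def by auto
    then have "diagonal_mat (mat_adjoint (R * R') * H * (R * R'))"
      using congruence_mult[OF H R(1) R'(1)] by simp
    with R R' show ?thesis unfolding solved_def
      by (intro bexI[of _ "R * R'"]) (auto simp: invertible_mat_mult[of _ n] respects_labels_mult)
  qed
  have keep: "mat_adjoint R * H * R \<in> carrier_mat n n \<and> hermitian_mat (mat_adjoint R * H * R)
    \<and> respects_labels n d (mat_adjoint R * H * R)"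
    if "form U H" "R \<in> carrier_mat n n" "respects_labels n d R" for U H R
    using that hermitian_mat_congruence[of H n R n] unfolding form_def
    by (auto intro!: respects_labels_mult respects_labels_adjoint mult_carrier_mat)
  have main: "solved H" if "finite U" "form U H" for U H
    using that
  proof (induction U arbitrary: H rule: finite_psubset_induct)
    case (psubset U)
    \<comment> \<open>The pivot row is cleared by subtracting the multiples \<open>H\<^sub>c\<^sub>b / H\<^sub>c\<^sub>c\<close> of the pivot column from the other columns.\<close>
    have pivot: "solved H" if H: "form U H" and c: "c < n" "c \<in> U" "H $$ (c, c) \<noteq> 0" for H c
    proof -
      let ?r = "\<lambda>b. if b = c then 0 else - H $$ (c, b) / H $$ (c, c)"
      let ?R = "transvection n c ?r"
      let ?H = "mat_adjoint ?R * H * ?R"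
      have Hc: "H \<in> carrier_mat n n" and h: "hermitian_mat H" and Hl: "respects_labels n d H"
        and z: "\<And>a b. a < n \<Longrightarrow> b < n \<Longrightarrow> a \<notin> U \<Longrightarrow> a \<noteq> b \<Longrightarrow> H $$ (a, b) = 0"
        using H unfolding form_def by auto
      have R: "respects_labels n d ?R"
      proof (rule respects_labels_transvection)
        fix b assume "b < n" "?r b \<noteq> 0"
        then have "H $$ (c, b) \<noteq> 0" by (auto split: if_splits)
        with Hl c(1) \<open>b < n\<close> show "d b = d c" unfolding respects_labels_def by metis
      qed
      note k = keep[OF H transvection_carrier R]
      have "?H $$ (a, b) = 0" if ab: "a < n" "b < n" "a \<notin> U - {c}" "a \<noteq> b" for a b
      proof (cases "a = c")
        case True
        then show ?thesis using c ab
          by (simp add: congruence_transvection_index[OF Hc c(1)] del: index_mult_mat)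
      next
        case False
        then have aU: "a \<notin> U" using ab by auto
        have "H $$ (c, a) = conjugate (H $$ (a, c))"
          using hermitian_mat_index[OF h Hc ab(1) c(1)] by simp
        with z[OF ab(1) c(1) aU False] z[OF ab(1,2) aU ab(4)] show ?thesis
          using False c ab by (simp add: congruence_transvection_index[OF Hc c(1)] del: index_mult_mat)
      qed
      with k have "form (U - {c}) ?H" unfolding form_def by blast
      with psubset.IH[of "U - {c}" ?H] c(2) have "solved ?H" by blast
      then show ?thesis
        using c by (intro transfer[OF Hc transvection_carrier invertible_transvection R]) auto
    qed
    note H = psubset.prems
    have Hc: "H \<in> carrier_mat n n" and h: "hermitian_mat H" and Hl: "respects_labels n d H"
      and z: "\<And>a b. a < n \<Longrightarrow> b < n \<Longrightarrow> a \<notin> U \<Longrightarrow> a \<noteq> b \<Longrightarrow> H $$ (a, b) = 0"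
      using H unfolding form_def by auto
    have zd: "H $$ (a, b) = 0" if "a < n" "b < n" "a \<notin> U \<or> b \<notin> U" "a \<noteq> b" for a b
      using z[of a b] z[of b a] hermitian_mat_index[OF h Hc, of b a] that by auto
    consider (diag) c where "c < n" "c \<in> U" "H $$ (c, c) \<noteq> 0"
      | (off) b c where "b < n" "c < n" "b \<in> U" "c \<in> U" "b \<noteq> c" "H $$ (c, b) \<noteq> 0" "\<And>a. a < n \<Longrightarrow> a \<in> U \<Longrightarrow> H $$ (a, a) = 0"
      | (zero) "\<And>a b. a < n \<Longrightarrow> b < n \<Longrightarrow> a \<noteq> b \<Longrightarrow> H $$ (a, b) = 0"
      using zd by blast
    then show ?case
    proof cases
      case diag
      with pivot H show ?thesis by blast
    next
      case off
      let ?t = "conjugate (H $$ (c, b))"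
      let ?r = "\<lambda>y. if y = c then ?t else 0"
      let ?R = "transvection n b ?r"
      let ?H = "mat_adjoint ?R * H * ?R"
      have R: "respects_labels n d ?R"
      proof (rule respects_labels_transvection)
        fix y assume "?r y \<noteq> 0"
        then have "y = c" by (auto split: if_splits)
        with Hl off(1,2,6) show "d y = d b" unfolding respects_labels_def by metis
      qed
      note k = keep[OF H transvection_carrier R]
      have "?H $$ (x, y) = 0" if xy: "x < n" "y < n" "x \<notin> U" "x \<noteq> y" for x y
      proof -
        have "x \<noteq> c" "x \<noteq> b" using xy off by auto
        with z[OF xy] z[OF xy(1) off(1) xy(3)] show ?thesis
          using xy by (simp add: congruence_transvection_index[OF Hc off(1)] del: index_mult_mat)
      qed
      with k have H': "form U ?H" unfolding form_def by blast
      have "?H $$ (c, c) = H $$ (c, b) * ?t + H $$ (c, b) * H $$ (b, c)"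
        using off by (simp add: congruence_transvection_index[OF Hc off(1)] del: index_mult_mat)
      also have "H $$ (b, c) = ?t" using hermitian_mat_index[OF h Hc off(2,1)] by simp
      finally have "?H $$ (c, c) = 2 * (H $$ (c, b) * ?t)" by simp
      then have "?H $$ (c, c) \<noteq> 0" using off(6) by simp
      from pivot[OF H' off(2,4) this] show ?thesis
        using off by (intro transfer[OF Hc transvection_carrier invertible_transvection R]) auto
    next
      case zero
      then have "diagonal_mat (mat_adjoint (1\<^sub>m n) * H * 1\<^sub>m n)"
        using Hc by (auto simp: diagonal_mat_def)
      then show ?thesis unfolding solved_def
        by (intro bexI[of _ "1\<^sub>m n"]) (auto simp: invertible_mat_iff_det[of _ n] respects_labels_def)
    qed
  qed
  have "form {..<n} H" using assms unfolding form_def by auto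
  from main[OF _ this] show ?thesis unfolding solved_def by simp
qed

section \<open>Pencils that contain a nonsingular matrix\<close>

text \<open>
  The eigenvalues are real, so the Hermitian matrices \<open>H\<close> and \<open>H \<Delta>\<^sub>i\<close> force \<open>H\<^sub>a\<^sub>b (\<mu>\<^sub>i\<^sub>a - \<mu>\<^sub>i\<^sub>b) = 0\<close>: joint
  eigenvectors with different eigenvalues are orthogonal for the form \<open>A\<close>. It remains to diagonalize
  \<open>A\<close> inside the joint eigenspaces, on which every \<open>C\<^sub>i\<close> is a multiple of \<open>A\<close>.
\<close>
lemma commuting_diagonalizable_imp_sdc:
  fixes A :: "'a::real_or_complex_field mat"
  assumes A: "A \<in> carrier_mat n n" "hermitian_mat A" "invertible_mat A"
    and C: "\<And>i. i < m \<Longrightarrow> C i \<in> carrier_mat n n" "\<And>i. i < m \<Longrightarrow> hermitian_mat (C i)"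
    and comm: "\<And>i j. i < m \<Longrightarrow> j < m \<Longrightarrow> inv_mat A * C i * (inv_mat A * C j) = inv_mat A * C j * (inv_mat A * C i)"
    and diag: "\<And>i. i < m \<Longrightarrow> \<exists>D\<in>carrier_mat n n. diagonal_mat D \<and> elements_mat D \<subseteq> \<real> \<and> similar_mat (inv_mat A * C i) D"
  shows "sdc n m C"
proof -
  note inv = inv_mat[OF A(1,3)]
  have "\<exists>Q\<in>carrier_mat n n. \<exists>\<mu>. invertible_mat Q \<and>
    (\<forall>i<m. inv_mat A * C i * Q = Q * mat_diag n (\<mu> i) \<and> (\<forall>c<n. \<mu> i c \<in> \<real>))"
    by (rule simultaneous_eigenbasis[where B = "\<lambda>i. inv_mat A * C i", OF diag comm])
  then obtain Q \<mu>
    where Q: "Q \<in> carrier_mat n n" "invertible_mat Q"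
      and \<mu>: "\<And>i. i < m \<Longrightarrow> inv_mat A * C i * Q = Q * mat_diag n (\<mu> i)"
      and real: "\<And>i c. i < m \<Longrightarrow> c < n \<Longrightarrow> \<mu> i c \<in> \<real>" by blast
  define H where "H = mat_adjoint Q * A * Q"
  note Q' = mat_adjoint_carrier[OF Q(1)]
  have H: "H \<in> carrier_mat n n"
    unfolding H_def by (rule mult_carrier_mat[OF mult_carrier_mat[OF Q' A(1)] Q(1)])
  have Hh: "hermitian_mat H" unfolding H_def by (rule hermitian_mat_congruence[OF A(1,2) Q(1)])
  have G: "mat_adjoint Q * C i * Q = H * mat_diag n (\<mu> i)" if i: "i < m" for i
  proof -
    have "C i * Q = A * inv_mat A * C i * Q" using C(1)[OF i] inv by simp
    also have "\<dots> = A * (inv_mat A * C i * Q)"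
      using A(1) inv(1) C(1)[OF i] Q(1) by (simp add: mult_carrier_mat[of _ n n _ n] assoc_mult_mat[of _ n n _ n _ n])
    also have "\<dots> = A * (Q * mat_diag n (\<mu> i))" by (simp add: \<mu> i)
    finally show ?thesis unfolding H_def
      using A(1) C(1)[OF i] Q(1) Q' by (simp add: mult_carrier_mat[of _ n n _ n] assoc_mult_mat[of _ n n _ n _ n])
  qed
  \<comment> \<open>Labels are lists of length \<open>m\<close>: the eigenvalues beyond index \<open>m\<close> carry no information.\<close>
  define d where "d a = map (\<lambda>i. \<mu> i a) [0..<m]" for a
  have d_eq: "d a = d b \<longleftrightarrow> (\<forall>i<m. \<mu> i a = \<mu> i b)" for a b by (auto simp: d_def)
  have Hl: "respects_labels n d H"
    unfolding respects_labels_def d_eq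
  proof (intro allI impI)
    fix a b i assume a: "a < n" and b: "b < n" and nz: "H $$ (a, b) \<noteq> 0" and i: "i < m"
    have "hermitian_mat (H * mat_diag n (\<mu> i))"
      using hermitian_mat_congruence[OF C[OF i] Q(1)] G[OF i] by simp
    from hermitian_mat_index[OF this mult_carrier_mat[OF H mat_diag_dim] b a]
    have "conjugate (H $$ (b, a)) * conjugate (\<mu> i a) = H $$ (a, b) * \<mu> i b"
      unfolding mat_diag_mult_right[OF H] using a b by (simp add: conjugate_dist_mul)
    moreover have "conjugate (H $$ (b, a)) = H $$ (a, b)"
      by (rule hermitian_mat_index[OF Hh H b a])
    moreover have "conjugate (\<mu> i a) = \<mu> i a"
      using real[OF i a] conjugate_fixed_iff_Reals by blast
    ultimately show "\<mu> i a = \<mu> i b" using nz by simp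
  qed
  from labelled_hermitian_diagonalization[OF H Hh Hl] obtain R
    where R: "R \<in> carrier_mat n n" "invertible_mat R" "respects_labels n d R"
      and RHR: "diagonal_mat (mat_adjoint R * H * R)" by blast
  note R' = mat_adjoint_carrier[OF R(1)]
  have RHRc: "mat_adjoint R * H * R \<in> carrier_mat n n"
    by (rule mult_carrier_mat[OF mult_carrier_mat[OF R' H] R(1)])
  show ?thesis unfolding sdc_def
  proof (intro bexI[of _ "Q * R"] conjI allI impI)
    fix i assume i: "i < m"
    have "mat_diag n (\<mu> i) * R = R * mat_diag n (\<mu> i)"
      unfolding mat_diag_mult_left[OF R(1)] mat_diag_mult_right[OF R(1)]
      using R(3) i unfolding respects_labels_def d_eq by (intro eq_matI) auto
    then have "mat_adjoint R * (H * mat_diag n (\<mu> i)) * R = mat_adjoint R * H * R * mat_diag n (\<mu> i)"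
      using H R(1) R' by (simp add: mult_carrier_mat[of _ n n _ n] assoc_mult_mat[of _ n n _ n _ n])
    then have "mat_adjoint (Q * R) * C i * (Q * R) = mat_adjoint R * H * R * mat_diag n (\<mu> i)"
      unfolding congruence_mult[OF C(1)[OF i] Q(1) R(1)] G[OF i] .
    then show "diagonal_mat (mat_adjoint (Q * R) * C i * (Q * R))"
      unfolding mat_diag_mult_right[OF RHRc] using RHR RHRc
      by (auto simp: diagonal_mat_def simp del: index_mult_mat(1))
  qed (use Q R in \<open>auto simp: invertible_mat_mult[of _ n] mult_carrier_mat[of _ n n _ n]\<close>)
qed

lemma congruence_real_lincomb:
  fixes C :: "nat \<Rightarrow> 'a::real_or_complex_field mat"
  assumes C: "\<And>i. i < m \<Longrightarrow> C i \<in> carrier_mat n n" and P: "P \<in> carrier_mat n n"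
  shows "mat_adjoint P * real_lincomb n m C l * P = real_lincomb n m (\<lambda>i. mat_adjoint P * C i * P) l"
proof (rule eq_matI)
  let ?A = "real_lincomb n m C l"
  have A: "?A \<in> carrier_mat n n" by (simp add: real_lincomb_def)
  fix x y assume "x < dim_row (real_lincomb n m (\<lambda>i. mat_adjoint P * C i * P) l)"
    "y < dim_col (real_lincomb n m (\<lambda>i. mat_adjoint P * C i * P) l)"
  then have xy: "x < n" "y < n" by (auto simp: real_lincomb_def)
  have "(mat_adjoint P * ?A * P) $$ (x, y)
    = (\<Sum>b<n. \<Sum>a<n. \<Sum>i<m. of_real (l $ i) * (conjugate (P $$ (a, x)) * C i $$ (a, b) * P $$ (b, y)))"
    unfolding congruence_index[OF A P xy]
    by (intro sum.cong refl) (auto simp: real_lincomb_def sum_distrib_left sum_distrib_right algebra_simps intro!: sum.cong)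
  also have "\<dots> = (\<Sum>b<n. \<Sum>i<m. \<Sum>a<n. of_real (l $ i) * (conjugate (P $$ (a, x)) * C i $$ (a, b) * P $$ (b, y)))"
    by (intro sum.cong refl sum.swap)
  also have "\<dots> = (\<Sum>i<m. \<Sum>b<n. \<Sum>a<n. of_real (l $ i) * (conjugate (P $$ (a, x)) * C i $$ (a, b) * P $$ (b, y)))"
    by (rule sum.swap)
  also have "\<dots> = (\<Sum>i<m. of_real (l $ i) * (mat_adjoint P * C i * P) $$ (x, y))"
    by (intro sum.cong refl) (simp add: congruence_index[OF C P xy] sum_distrib_left sum_distrib_right del: index_mult_mat(1))
  finally show "(mat_adjoint P * ?A * P) $$ (x, y) = real_lincomb n m (\<lambda>i. mat_adjoint P * C i * P) l $$ (x, y)"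
    using xy by (simp add: real_lincomb_def)
qed (use P in \<open>auto simp: real_lincomb_def\<close>)

lemma hermitian_real_lincomb:
  fixes C :: "nat \<Rightarrow> 'a::real_or_complex_field mat"
  assumes C: "\<And>i. i < m \<Longrightarrow> C i \<in> carrier_mat n n" "\<And>i. i < m \<Longrightarrow> hermitian_mat (C i)"
  shows "hermitian_mat (real_lincomb n m C l)"
proof -
  have r: "conjugate (of_real x :: 'a) = of_real x" for x
    by (simp add: conjugate_fixed_iff_Reals)
  show ?thesis unfolding hermitian_mat_def
    by (rule eq_matI)
      (auto simp: real_lincomb_def sum_conjugate conjugate_dist_mul r hermitian_mat_index[OF C(2,1)] intro!: sum.cong)
qed

text \<open>The diagonal forms are Hermitian, hence real.\<close>
lemma sdc_witness:
  fixes C :: "nat \<Rightarrow> 'a::real_or_complex_field mat"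
  assumes C: "\<And>i. i < m \<Longrightarrow> C i \<in> carrier_mat n n" "\<And>i. i < m \<Longrightarrow> hermitian_mat (C i)"
    and sdc: "sdc n m C"
  obtains P \<delta> where "P \<in> carrier_mat n n" "invertible_mat P"
    "\<And>i. i < m \<Longrightarrow> mat_adjoint P * C i * P = mat_diag n (\<lambda>j. of_real (\<delta> i j))"
proof -
  from sdc obtain P where P: "P \<in> carrier_mat n n" "invertible_mat P"
    "\<And>i. i < m \<Longrightarrow> diagonal_mat (mat_adjoint P * C i * P)" unfolding sdc_def by auto
  have "\<exists>x. (mat_adjoint P * C i * P) $$ (j, j) = of_real x" if i: "i < m" and j: "j < n" for i j
  proof -
    have "mat_adjoint P * C i * P \<in> carrier_mat n n"
      by (rule mult_carrier_mat[OF mult_carrier_mat[OF mat_adjoint_carrier[OF P(1)] C(1)[OF i]] P(1)])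
    from hermitian_mat_index[OF hermitian_mat_congruence[OF C[OF i] P(1)] this j j]
    show ?thesis unfolding conjugate_fixed_iff_Reals by (auto elim: Reals_cases)
  qed
  then obtain \<delta> where \<delta>: "\<And>i j. i < m \<Longrightarrow> j < n \<Longrightarrow> (mat_adjoint P * C i * P) $$ (j, j) = of_real (\<delta> i j)"
    by metis
  have "mat_adjoint P * C i * P = mat_diag n (\<lambda>j. of_real (\<delta> i j))" if i: "i < m" for i
  proof -
    have c: "mat_adjoint P * C i * P \<in> carrier_mat n n"
      by (rule mult_carrier_mat[OF mult_carrier_mat[OF mat_adjoint_carrier[OF P(1)] C(1)[OF i]] P(1)])
    show ?thesis
      by (subst diagonal_mat_eq_mat_diag[OF c P(3)[OF i]]) (auto simp: mat_diag_def \<delta>[OF i] simp del: index_mult_mat(1))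
  qed
  with P that show ?thesis by blast
qed

lemma real_lincomb_mat_diag:
  assumes "\<And>i. i < m \<Longrightarrow> D i = mat_diag n (\<lambda>j. of_real (\<delta> i j) :: 'a::real_field)"
  shows "real_lincomb n m D l = mat_diag n (\<lambda>j. of_real (\<Sum>i<m. l $ i * \<delta> i j))"
  using assms by (intro eq_matI) (auto simp: real_lincomb_def mat_diag_def)

text \<open>
  With \<open>P\<^sup>* A P = \<Delta>\<close> and \<open>P\<^sup>* C\<^sub>i P = \<Delta>\<^sub>i\<close>, cancelling \<open>P\<^sup>*\<close> in \<open>P\<^sup>* A P (\<Delta>\<^sup>-\<^sup>1 \<Delta>\<^sub>i) = P\<^sup>* C\<^sub>i P\<close> gives
  \<open>A\<^sup>-\<^sup>1 C\<^sub>i = P (\<Delta>\<^sup>-\<^sup>1 \<Delta>\<^sub>i) P\<^sup>-\<^sup>1\<close>.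
\<close>
lemma sdc_imp_commuting_diagonalizable:
  fixes C :: "nat \<Rightarrow> 'a::real_or_complex_field mat" and l :: "real vec"
  assumes C: "\<And>i. i < m \<Longrightarrow> C i \<in> carrier_mat n n" "\<And>i. i < m \<Longrightarrow> hermitian_mat (C i)"
    and sdc: "sdc n m C" and inv: "invertible_mat (real_lincomb n m C l)"
  defines "B \<equiv> \<lambda>i. inv_mat (real_lincomb n m C l) * C i"
  shows "i < m \<Longrightarrow> j < m \<Longrightarrow> B i * B j = B j * B i"
    and "i < m \<Longrightarrow> \<exists>D\<in>carrier_mat n n. diagonal_mat D \<and> elements_mat D \<subseteq> \<real> \<and> similar_mat (B i) D"
proof -
  let ?A = "real_lincomb n m C l"
  have A: "?A \<in> carrier_mat n n" by (simp add: real_lincomb_def)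
  note iA = inv_mat[OF A inv]
  from sdc_witness[OF C sdc] obtain P \<delta> where P: "P \<in> carrier_mat n n" "invertible_mat P"
    and D: "\<And>i. i < m \<Longrightarrow> mat_adjoint P * C i * P = mat_diag n (\<lambda>j. of_real (\<delta> i j))" by blast
  from invertible_matE[OF P(2,1)] obtain P' where P': "P' \<in> carrier_mat n n" "P * P' = 1\<^sub>m n" "P' * P = 1\<^sub>m n" by metis
  note Pa = mat_adjoint_carrier[OF P(1)]
  define s where "s j = (\<Sum>i<m. l $ i * \<delta> i j)" for j
  have PAP: "mat_adjoint P * ?A * P = mat_diag n (\<lambda>j. of_real (s j))"
    unfolding s_def by (rule trans[OF congruence_real_lincomb[OF C(1) P(1)] real_lincomb_mat_diag[OF D]])
  have "invertible_mat (mat_adjoint P * ?A * P)"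
    by (intro invertible_mat_mult[of _ n] mult_carrier_mat[OF Pa A] Pa A P inv invertible_mat_adjoint[OF P])
  then have s: "s j \<noteq> 0" if "j < n" for j
    unfolding PAP mat_diag_invertible_iff using that by auto
  define E where "E i = mat_diag n (\<lambda>j. of_real (\<delta> i j / s j) :: 'a)" for i
  have E: "E i \<in> carrier_mat n n" for i by (simp add: E_def)
  have B: "B i = P * E i * P'" if i: "i < m" for i
  proof -
    note Ci = C(1)[OF i]
    have PE: "P * E i \<in> carrier_mat n n" by (rule mult_carrier_mat[OF P(1) E])
    have Bi: "B i \<in> carrier_mat n n" unfolding B_def by (rule mult_carrier_mat[OF iA(1) Ci])
    note simps = mult_carrier_mat[of _ n n _ n] assoc_mult_mat[of _ n n _ n _ n]
    have "mat_adjoint P * ?A * P * E i = mat_adjoint P * C i * P"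
      unfolding PAP D[OF i] E_def mat_diag_diag using s by (intro eq_matI) (auto simp: mat_diag_def)
    then have "mat_adjoint P * (?A * (P * E i)) = mat_adjoint P * (C i * P)"
      using A P(1) Pa E[of i] Ci by (simp add: simps)
    then have AP: "?A * (P * E i) = C i * P"
      by (rule mult_mat_left_cancel[OF Pa invertible_mat_adjoint[OF P] mult_carrier_mat[OF A PE] mult_carrier_mat[OF Ci P(1)]])
    have "B i * P = inv_mat ?A * (?A * (P * E i))"
      unfolding B_def AP by (rule assoc_mult_mat[OF iA(1) Ci P(1)])
    also have "\<dots> = P * E i"
      using assoc_mult_mat[OF iA(1) A PE, symmetric] iA(3) left_mult_one_mat[OF PE] by simp
    finally have "B i * P * P' = P * E i * P'" by simp
    moreover have "B i * P * P' = B i"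
      using assoc_mult_mat[OF Bi P(1) P'(1)] P'(2) Bi by simp
    ultimately show ?thesis by simp
  qed
  show "i < m \<Longrightarrow> j < m \<Longrightarrow> B i * B j = B j * B i"
    using similarity_mult[OF P(1) P'(1,3) E E, of i j] similarity_mult[OF P(1) P'(1,3) E E, of j i]
    by (simp add: B) (simp add: E_def mult.commute)
  show "\<exists>D\<in>carrier_mat n n. diagonal_mat D \<and> elements_mat D \<subseteq> \<real> \<and> similar_mat (B i) D" if i: "i < m"
  proof (intro bexI[of _ "E i"] conjI)
    show "elements_mat (E i) \<subseteq> \<real>" by (auto simp: E_def mat_diag_def dest!: elements_matD)
    show "similar_mat (B i) (E i)"
      using P(1) P' E[of i] B[OF i] by (intro similar_matI[of _ _ P P' n]) (auto simp: mult_carrier_mat[of _ n n _ n])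
  qed (auto simp: E_def)
qed

text \<open>
  If the \<open>j\<close>-th diagonal entry vanished in all the diagonal forms, the \<open>j\<close>-th column of \<open>P\<close> would lie in
  the common kernel. So the polynomial in \<open>t\<close> whose coefficients are the \<open>j\<close>-th diagonal entries is
  nonzero for each \<open>j\<close>, and a common non-root \<open>t\<close> gives the coefficients \<open>t\<^sup>i\<close> of a nonsingular
  combination.
\<close>
lemma sdc_imp_nonsingular_lincomb:
  fixes C :: "nat \<Rightarrow> 'a::real_or_complex_field mat"
  assumes C: "\<And>i. i < m \<Longrightarrow> C i \<in> carrier_mat n n" "\<And>i. i < m \<Longrightarrow> hermitian_mat (C i)"
    and ker: "\<And>v. v \<in> carrier_vec n \<Longrightarrow> (\<And>i. i < m \<Longrightarrow> C i *\<^sub>v v = 0\<^sub>v n) \<Longrightarrow> v = 0\<^sub>v n"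
    and sdc: "sdc n m C"
  shows "\<exists>l\<in>carrier_vec m. det (real_lincomb n m C l) \<noteq> 0"
proof -
  from sdc_witness[OF C sdc] obtain P \<delta> where P: "P \<in> carrier_mat n n" "invertible_mat P"
    and D: "\<And>i. i < m \<Longrightarrow> mat_adjoint P * C i * P = mat_diag n (\<lambda>j. of_real (\<delta> i j))" by blast
  note Pa = mat_adjoint_carrier[OF P(1)]
  have nz: "\<exists>i<m. \<delta> i j \<noteq> 0" if j: "j < n" for j
  proof (rule ccontr)
    assume "\<not> (\<exists>i<m. \<delta> i j \<noteq> 0)"
    then have z: "\<delta> i j = 0" if "i < m" for i using that by auto
    let ?u = "unit_vec n j :: 'a vec"
    have u: "?u \<in> carrier_vec n" by simp
    have Pu: "P *\<^sub>v ?u \<in> carrier_vec n" using P by simp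
    have "C i *\<^sub>v (P *\<^sub>v ?u) = 0\<^sub>v n" if i: "i < m" for i
    proof (rule mult_mat_vec_invertible_eq_0[OF Pa invertible_mat_adjoint[OF P]])
      show "C i *\<^sub>v (P *\<^sub>v ?u) \<in> carrier_vec n" using C(1)[OF i] Pu by simp
      have "mat_adjoint P *\<^sub>v (C i *\<^sub>v (P *\<^sub>v ?u)) = (mat_adjoint P * C i * P) *\<^sub>v ?u"
        using Pa C(1)[OF i] P(1) u by (simp add: mult_carrier_mat[of _ n n _ n] assoc_mult_mat_vec[of _ n n _ n])
      also have "\<dots> = 0\<^sub>v n" unfolding D[OF i]
        using j by (intro eq_vecI) (auto simp: mat_diag_def z[OF i])
      finally show "mat_adjoint P *\<^sub>v (C i *\<^sub>v (P *\<^sub>v ?u)) = 0\<^sub>v n" .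
    qed
    from ker[OF Pu this] have "P *\<^sub>v ?u = 0\<^sub>v n" .
    from mult_mat_vec_invertible_eq_0[OF P u this] have "?u $ j = 0\<^sub>v n $ j" by simp
    with j show False by simp
  qed
  define p where "p j = (\<Sum>i<m. monom (\<delta> i j) i)" for j
  have p: "p j \<noteq> 0" if j: "j < n" for j
  proof -
    from nz[OF j] obtain i where i: "i < m" "\<delta> i j \<noteq> 0" by auto
    then have "coeff (p j) i \<noteq> 0" unfolding p_def by (simp add: coeff_sum if_distrib cong: if_cong)
    then show ?thesis by auto
  qed
  have "finite (\<Union>j<n. {t. poly (p j) t = 0})" using p by (auto intro: poly_roots_finite)
  then obtain t where t: "\<And>j. j < n \<Longrightarrow> poly (p j) t \<noteq> 0"
    using ex_new_if_finite[OF infinite_UNIV_char_0] by blast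
  define l where "l = vec m (\<lambda>i. t ^ i)"
  let ?A = "real_lincomb n m C l"
  have A: "?A \<in> carrier_mat n n" by (simp add: real_lincomb_def)
  have PA: "mat_adjoint P * ?A \<in> carrier_mat n n" by (rule mult_carrier_mat[OF Pa A])
  have "mat_adjoint P * ?A * P = mat_diag n (\<lambda>j. of_real (\<Sum>i<m. l $ i * \<delta> i j))"
    by (rule trans[OF congruence_real_lincomb[OF C(1) P(1)] real_lincomb_mat_diag[OF D]])
  also have "\<dots> = mat_diag n (\<lambda>j. of_real (poly (p j) t))"
    by (simp add: p_def l_def poly_sum poly_monom mult.commute)
  finally have "invertible_mat (mat_adjoint P * ?A * P)"
    using t by (simp add: mat_diag_invertible_iff)
  then have "det (mat_adjoint P * ?A * P) \<noteq> 0"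
    using invertible_mat_iff_det[OF mult_carrier_mat[OF PA P(1)]] by simp
  then have "det ?A \<noteq> 0" unfolding det_mult[OF PA P(1)] det_mult[OF Pa A] by simp
  then show ?thesis by (intro bexI[of _ l]) (auto simp: l_def)
qed

section \<open>Splitting off the common kernel\<close>

text \<open>
  Stacking the matrices on top of each other turns the common kernel into the kernel of one
  matrix.
\<close>
definition stacked_mat :: "nat \<Rightarrow> nat \<Rightarrow> (nat \<Rightarrow> 'a mat) \<Rightarrow> 'a mat" where
  "stacked_mat n m C = mat (m * n) n (\<lambda>(r, c). C (r div n) $$ (r mod n, c))"

lemma stacked_mat_carrier: "stacked_mat n m C \<in> carrier_mat (m * n) n"
  by (simp add: stacked_mat_def)

lemma common_kernel_eq:
  assumes m: "m \<ge> 1" and C: "\<And>i. i < m \<Longrightarrow> C i \<in> carrier_mat n n"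
  shows "common_kernel m C = {v \<in> carrier_vec n. \<forall>i<m. C i *\<^sub>v v = 0\<^sub>v n}"
proof -
  have "0 < m" using m by simp
  then have "v \<in> carrier_vec n" if "\<forall>i<m. v \<in> mat_kernel (C i)" for v
    using that mat_kernelD(1)[OF C, of 0] by blast
  then show ?thesis unfolding common_kernel_def by (auto simp: mat_kernel[OF C])
qed

lemma common_kernel_stacked:
  fixes C :: "nat \<Rightarrow> 'a::field mat"
  assumes m: "m \<ge> 1" and C: "\<And>i. i < m \<Longrightarrow> C i \<in> carrier_mat n n"
  shows "mat_kernel (stacked_mat n m C) = common_kernel m C"
proof -
  have "stacked_mat n m C *\<^sub>v v = 0\<^sub>v (m * n) \<longleftrightarrow> (\<forall>i<m. C i *\<^sub>v v = 0\<^sub>v n)"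
    if v: "v \<in> carrier_vec n" for v
  proof -
    have ent: "(stacked_mat n m C *\<^sub>v v) $ r = (C (r div n) *\<^sub>v v) $ (r mod n)" "r div n < m" "r mod n < n"
      if r: "r < m * n" for r
    proof -
      have n: "n > 0" using r by (cases n) auto
      with r show d: "r div n < m" "r mod n < n" by (auto simp: less_mult_imp_div_less)
      have "row (stacked_mat n m C) r = row (C (r div n)) (r mod n)"
        using r d C[OF d(1)] by (intro eq_vecI) (auto simp: stacked_mat_def)
      then show "(stacked_mat n m C *\<^sub>v v) $ r = (C (r div n) *\<^sub>v v) $ (r mod n)"
        using r d C[OF d(1)] by (simp add: stacked_mat_def)
    qed
    show ?thesis
    proof
      assume L: "stacked_mat n m C *\<^sub>v v = 0\<^sub>v (m * n)"
      show "\<forall>i<m. C i *\<^sub>v v = 0\<^sub>v n"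
      proof (intro allI impI eq_vecI)
        fix i x assume i: "i < m" and "x < dim_vec (0\<^sub>v n :: 'a vec)"
        then have x: "x < n" by simp
        have "i * n + x < Suc i * n" using x by simp
        also have "\<dots> \<le> m * n" using i by (intro mult_right_mono) auto
        finally have r: "i * n + x < m * n" .
        from ent(1)[OF r] L r x show "(C i *\<^sub>v v) $ x = 0\<^sub>v n $ x" by simp
      qed (use C in auto)
    next
      assume R: "\<forall>i<m. C i *\<^sub>v v = 0\<^sub>v n"
      show "stacked_mat n m C *\<^sub>v v = 0\<^sub>v (m * n)"
        using R ent by (intro eq_vecI) (auto simp: stacked_mat_def)
    qed
  qed
  moreover have "common_kernel m C = {v \<in> carrier_vec n. \<forall>i<m. C i *\<^sub>v v = 0\<^sub>v n}"
    by (rule common_kernel_eq[OF m C])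
  ultimately show ?thesis unfolding mat_kernel[OF stacked_mat_carrier] by auto
qed

text \<open>
  A basis of the kernel is a linearly independent set, and a maximal independent set above it is a
  basis of the whole space. List the kernel vectors first and take the list as the columns of \<open>P\<close>:
  in these coordinates the kernel is spanned by the first unit vectors.
\<close>
lemma kernel_adapted_basis:
  fixes A :: "'a::field mat"
  assumes A: "A \<in> carrier_mat nr n"
  shows "\<exists>P\<in>carrier_mat n n. invertible_mat P \<and> kernel.dim n A \<le> n \<and>
    (\<forall>v\<in>carrier_vec n. P *\<^sub>v v \<in> mat_kernel A \<longleftrightarrow> (\<forall>i<n. kernel.dim n A \<le> i \<longrightarrow> v $ i = 0))"
proof -
  interpret K: kernel nr n A by unfold_locales (rule A)
  from kernel_basis_exists[OF A] obtain S where S: "finite S" "K.basis S" by blast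
  have Sk: "S \<subseteq> mat_kernel A" and Sg: "K.span S = mat_kernel A" and Sl: "\<not> K.lin_dep S"
    using S(2) unfolding K.Ker.basis_def by auto
  have dim: "K.dim = card S" by (rule K.Ker.dim_basis[OF S])
  have Sc: "S \<subseteq> carrier_vec n" using Sk mat_kernel_carrier[OF A] by auto
  have Sl': "K.NC.lin_indpt S" using Sl K.lindep_same[OF Sk] by simp
  define good where "good T \<longleftrightarrow> S \<subseteq> T \<and> T \<subseteq> carrier_vec n \<and> K.NC.lin_indpt T" for T
  have "\<exists>T. finite T \<and> maximal T good"
  proof (rule maximal_exists)
    show "finite T \<and> card T \<le> n" if "good T" for T
      using that K.NC.li_le_dim[OF K.NC.fin_dim, of T] K.NC.dim_is_n unfolding good_def by auto
    show "good S" unfolding good_def using Sc Sl' by simp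
  qed
  then obtain T where T: "finite T" "maximal T good" by blast
  then have ST: "S \<subseteq> T" and Tc: "T \<subseteq> carrier_vec n" and Tl: "K.NC.lin_indpt T"
    unfolding maximal_def good_def by auto
  have "maximal T (\<lambda>T. T \<subseteq> carrier_vec n \<and> K.NC.lin_indpt T)"
    using T(2) ST unfolding maximal_def good_def by blast
  then have "K.NC.basis T" by (rule K.NC.max_li_is_basis)
  from K.NC.dim_basis[OF T(1) this] have cT: "card T = n" using K.NC.dim_is_n by simp
  obtain xs where xs: "set xs = S" "distinct xs" using finite_distinct_list[OF S(1)] by blast
  obtain ys where ys: "set ys = T - S" "distinct ys" using finite_distinct_list[of "T - S"] T(1) by blast
  define vs where "vs = xs @ ys"
  have vs: "set vs = T" "distinct vs" using xs ys ST by (auto simp: vs_def)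
  have len: "length vs = n" using distinct_card[OF vs(2)] vs(1) cT by simp
  have lxs: "length xs = K.dim" using distinct_card[OF xs(2)] xs(1) dim by simp
  define P where "P = mat_of_cols n vs"
  have P: "P \<in> carrier_mat n n" using len mat_of_cols_carrier(1)[of n vs] by (simp add: P_def)
  have cols: "cols P = vs" unfolding P_def using Tc vs by (intro cols_mat_of_cols) auto
  have "K.NC.rank P = n"
    using K.NC.lin_indpt_full_rank[OF P] cols vs Tl by simp
  then have inv: "invertible_mat P"
    using K.NC.det_rank_iff[OF P] invertible_mat_iff_det[OF P] by simp
  have colP: "col P j = vs ! j" if "j < n" for j
    using that cols P by (metis carrier_matD(2) cols_nth)
  have le: "K.dim \<le> n" using lxs len by (simp add: vs_def)
  have "P *\<^sub>v v \<in> mat_kernel A \<longleftrightarrow> (\<forall>i<n. K.dim \<le> i \<longrightarrow> v $ i = 0)" if v: "v \<in> carrier_vec n" for v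
  proof
    assume "P *\<^sub>v v \<in> mat_kernel A"
    then have "P *\<^sub>v v \<in> K.NC.span S" using Sg K.span_same[OF Sk] by simp
    then obtain a where a: "P *\<^sub>v v = K.NC.lincomb a S"
      using K.NC.finite_span[OF S(1) Sc] by auto
    define a' where "a' x = (if x \<in> S then a x else 0)" for x
    define w where "w = vec n (\<lambda>j. a' (col P j))"
    have w: "w \<in> carrier_vec n" by (simp add: w_def)
    have "P *\<^sub>v w = K.NC.lincomb a' T"
      using K.NC.mat_mult_eq_lincomb[OF P, of a'] cols vs unfolding w_def by simp
    also have "\<dots> = K.NC.lincomb a S"
    proof (rule eq_vecI)
      fix j assume "j < dim_vec (K.NC.lincomb a S)"
      then have j: "j < n" using K.NC.lincomb_dim[OF S(1) Sc] by simp
      show "K.NC.lincomb a' T $ j = K.NC.lincomb a S $ j"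
        unfolding K.NC.lincomb_index[OF j Tc] K.NC.lincomb_index[OF j Sc]
        using ST T(1) by (intro sum.mono_neutral_cong_right) (auto simp: a'_def)
    qed (use K.NC.lincomb_dim[OF S(1) Sc] K.NC.lincomb_dim[OF T(1) Tc] in simp)
    finally have "P *\<^sub>v v = P *\<^sub>v w" using a by simp
    then have "P *\<^sub>v (v - w) = P *\<^sub>v w - P *\<^sub>v w"
      by (simp add: mult_minus_distrib_mat_vec[OF P v w])
    also have "\<dots> = 0\<^sub>v n" using P w by (intro minus_cancel_vec) simp
    finally have "P *\<^sub>v (v - w) = 0\<^sub>v n" .
    from mult_mat_vec_invertible_eq_0[OF P inv _ this] have "v - w = 0\<^sub>v n" using v w by simp
    then have vw: "v $ i = w $ i" if "i < n" for i
      using that v w by (auto dest: arg_cong[of _ _ "\<lambda>x. x $ i"])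
    show "\<forall>i<n. K.dim \<le> i \<longrightarrow> v $ i = 0"
    proof (intro allI impI)
      fix i assume i: "i < n" "K.dim \<le> i"
      then have "vs ! i \<in> set ys" using lxs len by (auto simp: vs_def nth_append)
      then have "vs ! i \<notin> S" using ys by auto
      then show "v $ i = 0" using i by (simp add: vw) (simp add: w_def a'_def colP)
    qed
  next
    assume z: "\<forall>i<n. K.dim \<le> i \<longrightarrow> v $ i = 0"
    have AP0: "(A * P) $$ (r, j) = 0" if "r < nr" "j < K.dim" for r j
    proof -
      have "vs ! j \<in> S" using that lxs xs by (auto simp: vs_def nth_append)
      with Sk mat_kernelD[OF A] have "A *\<^sub>v (vs ! j) = 0\<^sub>v nr" by auto
      moreover have "(A * P) $$ (r, j) = (A *\<^sub>v col P j) $ r" using that le A P by simp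
      ultimately show ?thesis using that le colP[of j] by simp
    qed
    define M where "M = A * P"
    have M: "M \<in> carrier_mat nr n" unfolding M_def by (rule mult_carrier_mat[OF A P])
    have "M *\<^sub>v v = 0\<^sub>v nr"
    proof (rule eq_vecI)
      fix r assume "r < dim_vec (0\<^sub>v nr :: 'a vec)"
      then have r: "r < nr" by simp
      have "(M *\<^sub>v v) $ r = (\<Sum>j = 0..<n. M $$ (r, j) * v $ j)"
        using r M v by (simp add: scalar_prod_def)
      also have "\<dots> = 0"
      proof (rule sum.neutral, rule ballI)
        fix j assume "j \<in> {0..<n}"
        then show "M $$ (r, j) * v $ j = 0"
          using AP0[OF r, of j] z unfolding M_def[symmetric] by (cases "j < K.dim") auto
      qed
      finally show "(M *\<^sub>v v) $ r = 0\<^sub>v nr $ r" using r by simp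
    qed (use M in auto)
    then have "A *\<^sub>v (P *\<^sub>v v) = 0\<^sub>v nr" unfolding M_def assoc_mult_mat_vec[OF A P v] .
    then show "P *\<^sub>v v \<in> mat_kernel A"
      using A P v by (intro mat_kernelI) auto
  qed
  with P inv le show ?thesis by blast
qed

lemma common_kernel_adapted_basis:
  fixes C :: "nat \<Rightarrow> 'a::field mat"
  assumes m: "m \<ge> 1" and C: "\<And>i. i < m \<Longrightarrow> C i \<in> carrier_mat n n"
  obtains P where "P \<in> carrier_mat n n" "invertible_mat P" "common_kernel_dim n m C \<le> n"
    "\<And>v. v \<in> carrier_vec n \<Longrightarrow>
      (\<forall>i<m. C i *\<^sub>v (P *\<^sub>v v) = 0\<^sub>v n) \<longleftrightarrow> (\<forall>i<n. common_kernel_dim n m C \<le> i \<longrightarrow> v $ i = 0)"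
proof -
  have st: "mat_kernel (stacked_mat n m C) = common_kernel m C" by (rule common_kernel_stacked[OF m C])
  have ck: "common_kernel m C = {v \<in> carrier_vec n. \<forall>i<m. C i *\<^sub>v v = 0\<^sub>v n}"
    by (rule common_kernel_eq[OF m C])
  have "kernel.dim n (stacked_mat n m C) = common_kernel_dim n m C"
    unfolding common_kernel_dim_def st ..
  with kernel_adapted_basis[OF stacked_mat_carrier, of n m C] obtain P
    where P: "P \<in> carrier_mat n n" "invertible_mat P" "common_kernel_dim n m C \<le> n"
    and eq: "\<And>v. v \<in> carrier_vec n \<Longrightarrow>
      P *\<^sub>v v \<in> mat_kernel (stacked_mat n m C) \<longleftrightarrow> (\<forall>i<n. common_kernel_dim n m C \<le> i \<longrightarrow> v $ i = 0)"
    by auto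
  show ?thesis
  proof (rule that[OF P])
    fix v :: "'a vec" assume v: "v \<in> carrier_vec n"
    with P(1) have "P *\<^sub>v v \<in> carrier_vec n" by simp
    then show "(\<forall>i<m. C i *\<^sub>v (P *\<^sub>v v) = 0\<^sub>v n) \<longleftrightarrow> (\<forall>i<n. common_kernel_dim n m C \<le> i \<longrightarrow> v $ i = 0)"
      using eq[OF v] unfolding st ck by simp
  qed
qed

text \<open>
  In coordinates adapted to the common kernel the first \<open>q\<close> columns of every matrix vanish, and so
  do the first \<open>q\<close> rows by symmetry. A vector in the common kernel of the remaining blocks, extended
  by zeros, lies in the common kernel of the whole matrices, where the last coordinates are zero;
  so it is zero.
\<close>
lemma zero_block_reduction_exists:
  fixes C :: "nat \<Rightarrow> 'a::real_or_complex_field mat"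
  assumes m: "m \<ge> 1"
    and C: "\<And>i. i < m \<Longrightarrow> C i \<in> carrier_mat n n" "\<And>i. i < m \<Longrightarrow> hermitian_mat (C i)"
    and q: "q = common_kernel_dim n m C"
  shows "\<exists>P C'. zero_block_reduction n q m C P C'"
proof -
  from common_kernel_adapted_basis[where C = C, OF m C(1)] obtain P
    where P: "P \<in> carrier_mat n n" "invertible_mat P" and qn: "q \<le> n"
      and ker: "\<And>v. v \<in> carrier_vec n \<Longrightarrow>
        (\<forall>i<m. C i *\<^sub>v (P *\<^sub>v v) = 0\<^sub>v n) \<longleftrightarrow> (\<forall>i<n. q \<le> i \<longrightarrow> v $ i = 0)"
    unfolding q by blast
  note Pa = mat_adjoint_carrier[OF P(1)]
  define G where "G i = mat_adjoint P * C i * P" for i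
  define C' where "C' i = mat (n - q) (n - q) (\<lambda>(a, b). G i $$ (q + a, q + b))" for i
  have G: "G i \<in> carrier_mat n n" if "i < m" for i
    unfolding G_def by (rule mult_carrier_mat[OF mult_carrier_mat[OF Pa C(1)[OF that]] P(1)])
  have Gh: "hermitian_mat (G i)" if "i < m" for i
    unfolding G_def by (rule hermitian_mat_congruence[OF C[OF that] P(1)])
  have Gv: "G i *\<^sub>v v = mat_adjoint P *\<^sub>v (C i *\<^sub>v (P *\<^sub>v v))" if "i < m" "v \<in> carrier_vec n" for i v
    unfolding G_def using Pa C(1)[OF that(1)] P(1) that(2)
    by (simp add: mult_carrier_mat[of _ n n _ n] assoc_mult_mat_vec[of _ n n _ n])
  have Gcol: "G i $$ (a, j) = 0" if i: "i < m" and a: "a < n" and j: "j < q" for i a j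
  proof -
    let ?u = "unit_vec n j :: 'a vec"
    have jn: "j < n" using j qn by simp
    have "\<forall>i<m. C i *\<^sub>v (P *\<^sub>v ?u) = 0\<^sub>v n" using ker[of ?u] j jn by auto
    moreover have "mat_adjoint P *\<^sub>v 0\<^sub>v n = 0\<^sub>v n" by (rule mult_mat_zero_vec[OF Pa])
    ultimately have "G i *\<^sub>v ?u = 0\<^sub>v n" using Gv[OF i, of ?u] i by simp
    then have "(G i *\<^sub>v ?u) $ a = 0" using a by simp
    then show ?thesis using G[OF i] a jn by auto
  qed
  have Grow: "G i $$ (j, a) = 0" if "i < m" "a < n" "j < q" for i a j
    using hermitian_mat_index[OF Gh[OF that(1)] G[OF that(1)], of a j] Gcol[OF that] that qn by simp
  have "zero_block_reduction n q m C P C'"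
    unfolding zero_block_reduction_def
  proof (intro conjI allI impI)
    fix i assume i: "i < m"
    show "C' i \<in> carrier_mat (n - q) (n - q)" by (simp add: C'_def)
    show "hermitian_mat (C' i)" unfolding hermitian_mat_def
      by (rule eq_matI) (auto simp: C'_def hermitian_mat_index[OF Gh[OF i] G[OF i]])
    show "mat_adjoint P * C i * P = four_block_mat (0\<^sub>m q q) (0\<^sub>m q (n - q)) (0\<^sub>m (n - q) q) (C' i)"
      unfolding G_def[symmetric]
      by (rule eq_matI) (use qn G[OF i] Gcol[OF i] Grow[OF i] in \<open>auto simp: C'_def\<close>)
  next
    have C'c: "C' i \<in> carrier_mat (n - q) (n - q)" for i by (simp add: C'_def)
    have ck: "common_kernel m C' = {v \<in> carrier_vec (n - q). \<forall>i<m. C' i *\<^sub>v v = 0\<^sub>v (n - q)}"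
      by (rule common_kernel_eq[OF m C'c])
    show "common_kernel m C' = {0\<^sub>v (n - q)}"
    proof
      show "{0\<^sub>v (n - q)} \<subseteq> common_kernel m C'"
        unfolding ck using mult_mat_zero_vec[OF C'c] by auto
      show "common_kernel m C' \<subseteq> {0\<^sub>v (n - q)}"
      proof
        fix y assume "y \<in> common_kernel m C'"
        then have y: "y \<in> carrier_vec (n - q)" and Cy: "\<And>i. i < m \<Longrightarrow> C' i *\<^sub>v y = 0\<^sub>v (n - q)"
          unfolding ck by auto
        define w where "w = vec n (\<lambda>a. if a < q then 0 else y $ (a - q))"
        have w: "w \<in> carrier_vec n" by (simp add: w_def)
        have Pw: "P *\<^sub>v w \<in> carrier_vec n" using P(1) w by simp
        have "C i *\<^sub>v (P *\<^sub>v w) = 0\<^sub>v n" if i: "i < m" for i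
        proof (rule mult_mat_vec_invertible_eq_0[OF Pa invertible_mat_adjoint[OF P]])
          have "G i *\<^sub>v w = 0\<^sub>v n"
          proof (rule eq_vecI)
            fix a assume "a < dim_vec (0\<^sub>v n :: 'a vec)"
            then have a: "a < n" by simp
            have "(G i *\<^sub>v w) $ a = (\<Sum>b = 0..<n. G i $$ (a, b) * w $ b)"
              using G[OF i] a by (auto simp: scalar_prod_def w_def)
            also have "\<dots> = (\<Sum>b = q..<n. G i $$ (a, b) * y $ (b - q))"
              by (rule sum.mono_neutral_cong_right) (auto simp: w_def)
            also have "\<dots> = (\<Sum>b = 0..<n - q. G i $$ (a, b + q) * y $ b)"
              by (rule sum.reindex_bij_witness[of _ "\<lambda>b. b + q" "\<lambda>b. b - q"]) auto
            also have "\<dots> = 0"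
            proof (cases "a < q")
              case True
              then show ?thesis using Grow[OF i] by (intro sum.neutral) auto
            next
              case False
              have "(\<Sum>b = 0..<n - q. G i $$ (a, b + q) * y $ b) = (C' i *\<^sub>v y) $ (a - q)"
                using False a y by (auto simp: C'_def scalar_prod_def add.commute)
              then show ?thesis using Cy[OF i] False a by simp
            qed
            finally show "(G i *\<^sub>v w) $ a = 0\<^sub>v n $ a" using a by simp
          qed (use G[OF i] in auto)
          then show "mat_adjoint P *\<^sub>v (C i *\<^sub>v (P *\<^sub>v w)) = 0\<^sub>v n" using Gv[OF i w] by simp
          show "C i *\<^sub>v (P *\<^sub>v w) \<in> carrier_vec n" using C(1)[OF i] Pw by simp
        qed
        with ker[OF w] have wz: "w $ a = 0" if "a < n" "q \<le> a" for a using that by blast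
        have "y = 0\<^sub>v (n - q)"
        proof (rule eq_vecI)
          fix a assume "a < dim_vec (0\<^sub>v (n - q) :: 'a vec)"
          then show "y $ a = 0\<^sub>v (n - q) $ a" using wz[of "a + q"] by (simp add: w_def)
        qed (use y in auto)
        then show "y \<in> {0\<^sub>v (n - q)}" by simp
      qed
    qed
  qed (use P in auto)
  then show ?thesis by blast
qed

text \<open>
  The matrix \<open>[0 | 1]\<close> of the projection onto the last \<open>k\<close> coordinates. Congruence by it is the
  passage from \<open>M\<close> to \<open>0 \<oplus> M\<close>.
\<close>
definition drop_coords :: "nat \<Rightarrow> nat \<Rightarrow> 'a::{zero,one} mat" where
  "drop_coords q k = mat k (q + k) (\<lambda>(i, j). if j = q + i then 1 else 0)"

lemma drop_coords_carrier: "drop_coords q k \<in> carrier_mat k (q + k)"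
  by (simp add: drop_coords_def)

lemma mult_drop_coords:
  assumes M: "M \<in> carrier_mat l k"
  shows "M * drop_coords q k = mat l (q + k) (\<lambda>(i, j). if j < q then 0 else M $$ (i, j - q) :: 'a::semiring_1)"
proof (rule eq_matI)
  fix i j assume "i < dim_row (mat l (q + k) (\<lambda>(i, j). if j < q then 0 else M $$ (i, j - q)))"
    "j < dim_col (mat l (q + k) (\<lambda>(i, j). if j < q then 0 else M $$ (i, j - q)))"
  then have i: "i < l" and j: "j < q + k" by auto
  have "(M * drop_coords q k) $$ (i, j) = (\<Sum>c<k. if c = j - q \<and> q \<le> j then M $$ (i, c) else 0)"
    unfolding index_mult_mat_sum[OF M drop_coords_carrier i j]
    using j by (intro sum.cong) (auto simp: drop_coords_def)
  also have "\<dots> = (if j < q then 0 else M $$ (i, j - q))" using j by auto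
  finally show "(M * drop_coords q k) $$ (i, j) = mat l (q + k) (\<lambda>(i, j). if j < q then 0 else M $$ (i, j - q)) $$ (i, j)"
    using i j by simp
qed (use M in \<open>auto simp: drop_coords_def\<close>)

lemma congruence_drop_coords:
  fixes M :: "'a::conjugatable_field mat"
  assumes M: "M \<in> carrier_mat k k"
  shows "mat_adjoint (drop_coords q k) * M * drop_coords q k = four_block_mat (0\<^sub>m q q) (0\<^sub>m q k) (0\<^sub>m k q) M"
proof -
  let ?Z = "drop_coords q k :: 'a mat"
  have "mat_adjoint ?Z * M = mat_adjoint (mat_adjoint M * ?Z)"
    using mat_adjoint_mult[OF mat_adjoint_carrier[OF M] drop_coords_carrier] by simp
  also have "\<dots> = mat (q + k) k (\<lambda>(i, j). if i < q then 0 else M $$ (i - q, j))"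
    unfolding mult_drop_coords[OF mat_adjoint_carrier[OF M]] using M by (intro eq_matI) auto
  finally have "mat_adjoint ?Z * M * ?Z = mat (q + k) k (\<lambda>(i, j). if i < q then 0 else M $$ (i - q, j)) * ?Z" by simp
  also have "\<dots> = four_block_mat (0\<^sub>m q q) (0\<^sub>m q k) (0\<^sub>m k q) M"
    using M by (subst mult_drop_coords[OF mat_carrier]) (intro eq_matI, auto)
  finally show ?thesis .
qed

lemma drop_coords_adjoint: "drop_coords q k * mat_adjoint (drop_coords q k) = (1\<^sub>m k :: 'a::conjugatable_field mat)"
proof -
  have "(drop_coords q k * mat_adjoint (drop_coords q k)) $$ (i, j) = (1\<^sub>m k :: 'a mat) $$ (i, j)" if i: "i < k" and j: "j < k" for i j
  proof -
    have "(drop_coords q k * mat_adjoint (drop_coords q k) :: 'a mat) $$ (i, j)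
      = (\<Sum>c<q + k. if c = q + i then if i = j then 1 else 0 else 0)"
      unfolding index_mult_mat_sum[OF drop_coords_carrier mat_adjoint_carrier[OF drop_coords_carrier] i j]
      using i j by (intro sum.cong) (auto simp: drop_coords_def)
    then show ?thesis using i j by simp
  qed
  then show ?thesis by (intro eq_matI) (auto simp: drop_coords_def simp del: index_mult_mat(1))
qed

text \<open>
  If \<open>R\<close> diagonalizes the matrices \<open>0 \<oplus> C'\<^sub>i\<close> then its lower part \<open>W = [0 | 1] R\<close> makes all \<open>W\<^sup>* C'\<^sub>i W\<close>
  diagonal. The matrix \<open>R\<^sup>-\<^sup>1 [0 | 1]\<^sup>*\<close> is a right inverse of \<open>W\<close>, so some selection of columns of \<open>W\<close> is
  invertible; it picks a principal submatrix of each diagonal matrix. Conversely, \<open>1 \<oplus> U\<close>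
  diagonalizes the larger matrices when \<open>U\<close> diagonalizes the smaller ones.
\<close>
lemma sdc_zero_block:
  fixes C' :: "nat \<Rightarrow> 'a::real_or_complex_field mat"
  assumes C': "\<And>i. i < m \<Longrightarrow> C' i \<in> carrier_mat k k"
  shows "sdc (q + k) m (\<lambda>i. four_block_mat (0\<^sub>m q q) (0\<^sub>m q k) (0\<^sub>m k q) (C' i)) \<longleftrightarrow> sdc k m C'"
proof
  let ?Z = "drop_coords q k :: 'a mat"
  note Z = drop_coords_carrier[of q k]
  assume "sdc (q + k) m (\<lambda>i. four_block_mat (0\<^sub>m q q) (0\<^sub>m q k) (0\<^sub>m k q) (C' i))"
  then obtain R where R: "R \<in> carrier_mat (q + k) (q + k)" "invertible_mat R"
    and "\<And>i. i < m \<Longrightarrow> diagonal_mat (mat_adjoint R * four_block_mat (0\<^sub>m q q) (0\<^sub>m q k) (0\<^sub>m k q) (C' i) * R)"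
    unfolding sdc_def by auto
  then have diag: "diagonal_mat (mat_adjoint (?Z * R) * C' i * (?Z * R))" if "i < m" for i
    using that congruence_mult[OF C'[OF that] Z R(1)] congruence_drop_coords[OF C'[OF that], of q] by simp
  define W where "W = ?Z * R"
  have W: "W \<in> carrier_mat k (q + k)" unfolding W_def by (rule mult_carrier_mat[OF Z R(1)])
  from invertible_matE[OF R(2,1)] obtain R' where R': "R' \<in> carrier_mat (q + k) (q + k)" "R * R' = 1\<^sub>m (q + k)" by metis
  have Y: "R' * mat_adjoint ?Z \<in> carrier_mat (q + k) k" by (rule mult_carrier_mat[OF R'(1) mat_adjoint_carrier[OF Z]])
  note Za = mat_adjoint_carrier[OF Z]
  have "W * (R' * mat_adjoint ?Z) = ?Z * (R * (R' * mat_adjoint ?Z))"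
    unfolding W_def by (rule assoc_mult_mat[OF Z R(1) Y])
  also have "R * (R' * mat_adjoint ?Z) = mat_adjoint ?Z"
    using assoc_mult_mat[OF R(1) R'(1) Za, symmetric] R'(2) left_mult_one_mat[OF Za] by simp
  also have "?Z * mat_adjoint ?Z = 1\<^sub>m k" by (rule drop_coords_adjoint)
  finally have "W * (R' * mat_adjoint ?Z) = 1\<^sub>m k" .
  from nonsingular_column_selection[OF W Y this] obtain f
    where f: "\<And>c. c < k \<Longrightarrow> f c < q + k" "inj_on f {..<k}"
      and inv: "invertible_mat (mat k k (\<lambda>(r, c). W $$ (r, f c)))" by blast
  define V where "V = mat k k (\<lambda>(r, c). W $$ (r, f c))"
  have V: "V \<in> carrier_mat k k" by (simp add: V_def)
  have "diagonal_mat (mat_adjoint V * C' i * V)" if i: "i < m" for i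
    unfolding diagonal_mat_def
  proof (intro allI impI)
    fix x y assume "x < dim_row (mat_adjoint V * C' i * V)" "y < dim_col (mat_adjoint V * C' i * V)" and ne: "x \<noteq> y"
    with V have xy: "x < k" "y < k" by auto
    with f ne have fxy: "f x < q + k" "f y < q + k" "f x \<noteq> f y" by (auto simp: inj_on_def)
    have "(mat_adjoint V * C' i * V) $$ (x, y) = (mat_adjoint W * C' i * W) $$ (f x, f y)"
      unfolding congruence_index[OF C'[OF i] V xy] congruence_index[OF C'[OF i] W fxy(1,2)]
      using xy by (intro sum.cong refl) (auto simp: V_def)
    also have "\<dots> = 0" using diag[OF i] fxy W unfolding W_def[symmetric] diagonal_mat_def by simp
    finally show "(mat_adjoint V * C' i * V) $$ (x, y) = 0" .
  qed
  with V inv show "sdc k m C'" unfolding sdc_def V_def by blast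
next
  let ?Z = "drop_coords q k :: 'a mat"
  note Z = drop_coords_carrier[of q k]
  assume "sdc k m C'"
  then obtain U where U: "U \<in> carrier_mat k k" "invertible_mat U"
    and diag: "\<And>i. i < m \<Longrightarrow> diagonal_mat (mat_adjoint U * C' i * U)" unfolding sdc_def by auto
  from invertible_matE[OF U(2,1)] obtain U' where U': "U' \<in> carrier_mat k k" "U * U' = 1\<^sub>m k" by metis
  define R where "R X = four_block_mat (1\<^sub>m q) (0\<^sub>m q k) (0\<^sub>m k q) X" for X :: "'a mat"
  have R: "R X \<in> carrier_mat (q + k) (q + k)" if "X \<in> carrier_mat k k" for X
    unfolding R_def using that by (intro four_block_carrier_mat) auto
  have "R U * R U' = R (U * U')"
    unfolding R_def using U(1) U'(1)
    by (subst mult_four_block_mat[of _ q q _ k _ k _ _ q _ k]) auto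
  also have "\<dots> = 1\<^sub>m (q + k)" unfolding U'(2) R_def by (rule eq_matI) auto
  finally have inv: "invertible_mat (R U)" by (rule invertible_matI[OF R[OF U(1)] R[OF U'(1)]])
  have ZR: "?Z * R U = U * ?Z"
    unfolding mult_drop_coords[OF U(1)]
  proof (rule eq_matI)
    fix i j assume "i < dim_row (mat k (q + k) (\<lambda>(i, j). if j < q then 0 else U $$ (i, j - q)))"
      "j < dim_col (mat k (q + k) (\<lambda>(i, j). if j < q then 0 else U $$ (i, j - q)))"
    then have i: "i < k" and j: "j < q + k" by auto
    have "(?Z * R U) $$ (i, j) = (\<Sum>c<q + k. if c = q + i then R U $$ (c, j) else 0)"
      unfolding index_mult_mat_sum[OF Z R[OF U(1)] i j] using i by (intro sum.cong) (auto simp: drop_coords_def)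
    also have "\<dots> = R U $$ (q + i, j)" using i by simp
    finally show "(?Z * R U) $$ (i, j) = mat k (q + k) (\<lambda>(i, j). if j < q then 0 else U $$ (i, j - q)) $$ (i, j)"
      using i j U(1) by (simp add: R_def)
  qed (use R[OF U(1)] in \<open>auto simp: drop_coords_def\<close>)
  show "sdc (q + k) m (\<lambda>i. four_block_mat (0\<^sub>m q q) (0\<^sub>m q k) (0\<^sub>m k q) (C' i))"
    unfolding sdc_def
  proof (intro bexI[of _ "R U"] conjI allI impI)
    fix i assume i: "i < m"
    have D: "mat_adjoint U * C' i * U \<in> carrier_mat k k"
      by (rule mult_carrier_mat[OF mult_carrier_mat[OF mat_adjoint_carrier[OF U(1)] C'[OF i]] U(1)])
    have "mat_adjoint (R U) * four_block_mat (0\<^sub>m q q) (0\<^sub>m q k) (0\<^sub>m k q) (C' i) * R U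
      = mat_adjoint (U * ?Z) * C' i * (U * ?Z)"
      using congruence_mult[OF C'[OF i] Z R[OF U(1)]] congruence_drop_coords[OF C'[OF i], of q] ZR by simp
    also have "\<dots> = four_block_mat (0\<^sub>m q q) (0\<^sub>m q k) (0\<^sub>m k q) (mat_adjoint U * C' i * U)"
      using congruence_mult[OF C'[OF i] U(1) Z] congruence_drop_coords[OF D, of q] by simp
    also have "diagonal_mat \<dots>"
      using diag[OF i] D unfolding diagonal_mat_def by (auto simp del: index_mult_mat(1))
    finally show "diagonal_mat (mat_adjoint (R U) * four_block_mat (0\<^sub>m q q) (0\<^sub>m q k) (0\<^sub>m k q) (C' i) * R U)" .
  qed (use inv R[OF U(1)] in auto)
qed

section \<open>The characterization\<close>

text \<open>
  A coordinate description of the common kernel yields both \<open>q < n\<close> and, for \<open>q = 0\<close>, the triviality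
  of the kernel as a set.
\<close>
lemma sdc_characterization:
  fixes C :: "nat \<Rightarrow> 'a::real_or_complex_field mat"
  assumes m: "m \<ge> 1"
    and C: "\<forall>i<m. C i \<in> carrier_mat n n \<and> C i \<noteq> 0\<^sub>m n n \<and> hermitian_mat (C i)"
    and q: "q = common_kernel_dim n m C"
  shows "q < n \<and>
         (q = 0 \<longrightarrow>
            ((\<forall>l \<in> carrier_vec m. det (real_lincomb n m C l) = 0) \<longrightarrow> \<not> sdc n m C) \<and>
            (\<forall>l \<in> carrier_vec m. invertible_mat (real_lincomb n m C l) \<longrightarrow>
               (let B = (\<lambda>i. inv_mat (real_lincomb n m C l) * C i) in
                  sdc n m C \<longleftrightarrow>
                    (\<forall>i<m. \<forall>j<m. B i * B j = B j * B i) \<and>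
                    (\<forall>i<m. \<exists>D \<in> carrier_mat n n.
                       diagonal_mat D \<and> elements_mat D \<subseteq> \<real> \<and> similar_mat (B i) D)))) \<and>
         (q > 0 \<longrightarrow>
            (\<exists>P C'. zero_block_reduction n q m C P C') \<and>
            (\<forall>P C'. zero_block_reduction n q m C P C' \<longrightarrow>
               (sdc n m C \<longleftrightarrow> sdc (n - q) m C')))"
proof -
  have Cc: "\<And>i. i < m \<Longrightarrow> C i \<in> carrier_mat n n" and Ch: "\<And>i. i < m \<Longrightarrow> hermitian_mat (C i)"
    using C by auto
  from common_kernel_adapted_basis[where C = C, OF m Cc] obtain P
    where P: "P \<in> carrier_mat n n" "invertible_mat P" and qn: "q \<le> n"
      and ker: "\<And>v. v \<in> carrier_vec n \<Longrightarrow>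
        (\<forall>i<m. C i *\<^sub>v (P *\<^sub>v v) = 0\<^sub>v n) \<longleftrightarrow> (\<forall>i<n. q \<le> i \<longrightarrow> v $ i = 0)"
    unfolding q by blast
  from invertible_matE[OF P(2,1)] obtain P'
    where P': "P' \<in> carrier_mat n n" "P * P' = 1\<^sub>m n" by metis
  have ker': "(\<forall>i<m. C i *\<^sub>v v = 0\<^sub>v n) \<longleftrightarrow> (\<forall>i<n. q \<le> i \<longrightarrow> (P' *\<^sub>v v) $ i = 0)"
    if v: "v \<in> carrier_vec n" for v
  proof -
    have "P *\<^sub>v (P' *\<^sub>v v) = v"
      using assoc_mult_mat_vec[OF P(1) P'(1) v] P'(2) v by simp
    with ker[of "P' *\<^sub>v v"] P'(1) v show ?thesis by simp
  qed
  have "q \<noteq> n"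
  proof
    assume "q = n"
    have "C 0 $$ (a, j) = 0" if aj: "a < n" "j < n" for a j
    proof -
      have "\<forall>i<m. C i *\<^sub>v unit_vec n j = 0\<^sub>v n" using ker'[of "unit_vec n j"] \<open>q = n\<close> by simp
      with m have "(C 0 *\<^sub>v unit_vec n j) $ a = 0\<^sub>v n $ a" by simp
      with aj Cc[of 0] m show ?thesis by simp
    qed
    then have "C 0 = 0\<^sub>m n n" using Cc[of 0] m by (intro eq_matI) auto
    with C m show False by auto
  qed
  with qn have "q < n" by simp
  moreover have "\<not> sdc n m C"
    if "q = 0" and sing: "\<forall>l \<in> carrier_vec m. det (real_lincomb n m C l) = 0"
  proof
    assume s: "sdc n m C"
    have "v = 0\<^sub>v n" if v: "v \<in> carrier_vec n" and "\<And>i. i < m \<Longrightarrow> C i *\<^sub>v v = 0\<^sub>v n" for v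
    proof -
      from ker'[OF v] that(2) \<open>q = 0\<close> have "P' *\<^sub>v v = 0\<^sub>v n" using P'(1) by (intro eq_vecI) auto
      from mult_mat_vec_invertible_eq_0[OF P'(1) invertible_mat_inverse[OF P(1) P'] v this] show ?thesis .
    qed
    from sdc_imp_nonsingular_lincomb[OF Cc Ch this s] sing show False by blast
  qed
  moreover have "sdc n m C \<longleftrightarrow>
      (\<forall>i<m. \<forall>j<m. B i * B j = B j * B i) \<and>
      (\<forall>i<m. \<exists>D \<in> carrier_mat n n. diagonal_mat D \<and> elements_mat D \<subseteq> \<real> \<and> similar_mat (B i) D)"
    if inv: "invertible_mat (real_lincomb n m C l)" and B: "B = (\<lambda>i. inv_mat (real_lincomb n m C l) * C i)" for l B
  proof (rule iffI)
    assume s: "sdc n m C"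
    from sdc_imp_commuting_diagonalizable[OF Cc Ch s inv]
    show "(\<forall>i<m. \<forall>j<m. B i * B j = B j * B i) \<and>
      (\<forall>i<m. \<exists>D \<in> carrier_mat n n. diagonal_mat D \<and> elements_mat D \<subseteq> \<real> \<and> similar_mat (B i) D)"
      unfolding B by blast
  next
    assume R: "(\<forall>i<m. \<forall>j<m. B i * B j = B j * B i) \<and>
      (\<forall>i<m. \<exists>D \<in> carrier_mat n n. diagonal_mat D \<and> elements_mat D \<subseteq> \<real> \<and> similar_mat (B i) D)"
    have A: "real_lincomb n m C l \<in> carrier_mat n n" by (simp add: real_lincomb_def)
    show "sdc n m C"
      by (rule commuting_diagonalizable_imp_sdc[OF A hermitian_real_lincomb[OF Cc Ch] inv Cc Ch])
        (use R in \<open>auto simp: B\<close>)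
  qed
  moreover have "\<exists>P C'. zero_block_reduction n q m C P C'"
    by (rule zero_block_reduction_exists[OF m Cc Ch q])
  moreover have "sdc n m C \<longleftrightarrow> sdc (n - q) m C'" if "zero_block_reduction n q m C P C'" for P C'
  proof -
    from that have P: "P \<in> carrier_mat n n" "invertible_mat P"
      and C': "\<And>i. i < m \<Longrightarrow> C' i \<in> carrier_mat (n - q) (n - q)"
      and blk: "\<And>i. i < m \<Longrightarrow> mat_adjoint P * C i * P =
        four_block_mat (0\<^sub>m q q) (0\<^sub>m q (n - q)) (0\<^sub>m (n - q) q) (C' i)"
      unfolding zero_block_reduction_def by auto
    have "sdc n m C \<longleftrightarrow> sdc n m (\<lambda>i. mat_adjoint P * C i * P)"
      by (rule sdc_congruence[OF P Cc, symmetric])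
    also have "\<dots> \<longleftrightarrow> sdc n m (\<lambda>i. four_block_mat (0\<^sub>m q q) (0\<^sub>m q (n - q)) (0\<^sub>m (n - q) q) (C' i))"
      by (rule sdc_cong) (rule blk)
    also have "\<dots> \<longleftrightarrow> sdc (n - q) m C'"
      using sdc_zero_block[where q = q, OF C'] qn by simp
    finally show ?thesis .
  qed
  ultimately show ?thesis by (simp add: Let_def)
qed

theorem theorem4:
  shows
    "(\<forall>(n::nat) (m::nat) (q::nat) (C :: nat \<Rightarrow> real mat).
       m \<ge> 1 \<longrightarrow>
       (\<forall>i<m. C i \<in> carrier_mat n n \<and> C i \<noteq> 0\<^sub>m n n \<and> hermitian_mat (C i)) \<longrightarrow>
       q = common_kernel_dim n m C \<longrightarrow>
         q < n \<and>
         (q = 0 \<longrightarrow>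
            ((\<forall>l \<in> carrier_vec m. det (real_lincomb n m C l) = 0) \<longrightarrow> \<not> sdc n m C) \<and>
            (\<forall>l \<in> carrier_vec m. invertible_mat (real_lincomb n m C l) \<longrightarrow>
               (let B = (\<lambda>i. inv_mat (real_lincomb n m C l) * C i) in
                  sdc n m C \<longleftrightarrow>
                    (\<forall>i<m. \<forall>j<m. B i * B j = B j * B i) \<and>
                    (\<forall>i<m. \<exists>D \<in> carrier_mat n n.
                       diagonal_mat D \<and> elements_mat D \<subseteq> \<real> \<and> similar_mat (B i) D)))) \<and>
         (q > 0 \<longrightarrow>
            (\<exists>P C'. zero_block_reduction n q m C P C') \<and>
            (\<forall>P C'. zero_block_reduction n q m C P C' \<longrightarrow>
               (sdc n m C \<longleftrightarrow> sdc (n - q) m C'))))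
     \<and>
     (\<forall>(n::nat) (m::nat) (q::nat) (C :: nat \<Rightarrow> complex mat).
       m \<ge> 1 \<longrightarrow>
       (\<forall>i<m. C i \<in> carrier_mat n n \<and> C i \<noteq> 0\<^sub>m n n \<and> hermitian_mat (C i)) \<longrightarrow>
       q = common_kernel_dim n m C \<longrightarrow>
         q < n \<and>
         (q = 0 \<longrightarrow>
            ((\<forall>l \<in> carrier_vec m. det (real_lincomb n m C l) = 0) \<longrightarrow> \<not> sdc n m C) \<and>
            (\<forall>l \<in> carrier_vec m. invertible_mat (real_lincomb n m C l) \<longrightarrow>
               (let B = (\<lambda>i. inv_mat (real_lincomb n m C l) * C i) in
                  sdc n m C \<longleftrightarrow>
                    (\<forall>i<m. \<forall>j<m. B i * B j = B j * B i) \<and>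
                    (\<forall>i<m. \<exists>D \<in> carrier_mat n n.
                       diagonal_mat D \<and> elements_mat D \<subseteq> \<real> \<and> similar_mat (B i) D)))) \<and>
         (q > 0 \<longrightarrow>
            (\<exists>P C'. zero_block_reduction n q m C P C') \<and>
            (\<forall>P C'. zero_block_reduction n q m C P C' \<longrightarrow>
               (sdc n m C \<longleftrightarrow> sdc (n - q) m C'))))"
  by (rule conjI; intro allI impI; rule sdc_characterization)

end
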